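(* Let $X$ be an infinite-dimensional real separable Hilbert space of functions over a domain $D\subset\mathbb{R}^d$ ($d\in\{1,2,3\}$), let $\mathcal{A}$ be a Laplacian-like operator on $X$ (see context), let $\alpha>d/2$, and let $\mathcal{C}_0=\mathcal{A}^{-\alpha}$. Consider a linear Bayesian inverse problem with Gaussian prior $\mathcal{N}(m_0,\mathcal{C}_0)$ and bounded linear parameter-to-observable map $G:X\to Y$, so that the posterior is the Gaussian measure $\mathcal{N}(m_1,\mathcal{C}_1)$ with $\mathcal{C}_1=(G^*\Gamma_{\text{noise}}^{-1}G+\mathcal{C}_0^{-1})^{-1}$ and $m_1$ the MAP point. Let $(\lambda_j^1,\psi_j^1)_{j\ge1}$ be the eigenpairs of $\mathcal{C}_1$ ($\lambda_j^1$ non-increasing, $(\psi_j^1)_{j\ge1}$ orthonormal in $X$), and let $$m^1(\boldsymbol\xi)=m_1+\sum_{j\ge1}\sqrt{\lambda_j^1}\,\psi_j^1\,\xi_j,\qquad\boldsymbol\xi=(\xi_j)_{j\ge1}\in\Xi=\mathbb{R}^\infty,$$ where $\Xi$ carries the product $\mu$ of standard Gaussian measures. Let $f:X\to\mathbb{R}$ be a bounded linear functional, let $k\ge1$ be an integer, and let $Q(m)=f(m)^k$. Then for every $s<\frac{\alpha}{d}-1$ there exist $0<q<1$, a positive sequence $\boldsymbol\tau=(\tau_j)_{j\ge1}$ with $(\tau_j^{-1})_{j\ge1}\in\ell^q(\mathbb{N})$, and a constant $C$ independent of $N$ such that, for every $N\ge1$, there is an admissible index set $\Lambda_N\subset\mathcal{F}$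 consisting of $N$ indices $\boldsymbol\nu$ corresponding to the $N$ smallest values of $b_{\boldsymbol\nu}$ (defined in the context from $\boldsymbol\tau$ and $q$), for which the sparse quadrature error is bounded by $$\left|\mathbb{E}^\mu(Q)-\mathcal{Q}_{\Lambda_N}(Q)\right|\le C(N+1)^{-s},$$ where $\mathbb{E}^\mu(Q)=\int_\Xi Q(m^1(\boldsymbol\xi))\,d\mu(\boldsymbol\xi)$ and $\mathcal{Q}_{\Lambda_N}(Q)$ is the sparse quadrature applied to the function $\boldsymbol\xi\mapsto Q(m^1(\boldsymbol\xi))$.
   Context: Laplacian-like operator: $\mathcal{A}$ is a (densely defined, unbounded) positive definite, self-adjoint, invertible operator on $X$ with eigenpairs $\{(\lambda_j,\psi_j)\}_{j\ge1}$, where $(\psi_j)_{j\ge1}$ is an orthonormal basis of $X$ and the eigenvalues $\lambda_j$ (listed in non-decreasing order) grow asymptotically as $j^{2/d}$ (i.e. $\lambda_j$ is bounded above and below by positive constant multiples of $j^{2/d}$), so that $(\lambda_j^{-1})_{j\ge1}\in\ell^q$ for all $q>d/2$. The power $\mathcal{A}^{-\alpha}$ is defined spectrally. Bayesian setting: the data are $y=Gm+\eta$ in a separable Hilbert space $Y$ (typically $\mathbb{R}^K$), with noise $\eta\sim\mathcal{N}(0,\Gamma_{\text{noise}})$, where $\Gamma_{\text{noise}}$ is self-adjoint, positive definite and boundedly invertible; $G^*:Y\to X$ is the adjoint of $G$. The MAP point $m_1\in X$ is the minimizer of $\frac12\langle y-Gm,\Gamma_{\text{noise}}^{-1}(y-Gm)\rangle+\frac12\|\mathcal{C}_0^{-1/2}(m-m_0)\|_X^2$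 over the Cameron–Martin space of the prior. Multi-indices: $\mathcal{F}$ is the set of $\boldsymbol\nu=(\nu_1,\nu_2,\dots)$ of non-negative integers with finitely many nonzero entries. A set $\Lambda\subset\mathcal{F}$ is admissible if $\boldsymbol\nu\in\Lambda$ implies $\boldsymbol\mu\in\Lambda$ for every $\boldsymbol\mu\in\mathcal{F}$ with $\mu_j\le\nu_j$ for all $j$. Weights: given $0<q<1$ and a positive sequence $\boldsymbol\tau$ with $(\tau_j^{-1})\in\ell^q(\mathbb{N})$, let $r$ be the smallest integer with $r>14/q$ and $$b_{\boldsymbol\nu}=\sum_{\boldsymbol\mu\in\mathcal{F},\,|\boldsymbol\mu|_\infty\le r}\binom{\boldsymbol\nu}{\boldsymbol\mu}\boldsymbol\tau^{2\boldsymbol\mu},\qquad \binom{\boldsymbol\nu}{\boldsymbol\mu}=\prod_{j\ge1}\binom{\nu_j}{\mu_j},\quad \boldsymbol\tau^{2\boldsymbol\mu}=\prod_{j\ge1}\tau_j^{2\mu_j},\quad |\boldsymbol\mu|_\infty=\max_j\mu_j,$$ with $\binom{n}{k}=0$ for $k>n$. Sparse quadrature (Gauss–Hermite): for $n=0,1,2,\dots$ let $\mathcal{Q}_n$ be the univariate Gauss–Hermite quadrature for the standard Gaussian density $\frac{1}{\sqrt{2\pi}}e^{-\xi^2/2}$ with $n+1$ points (exact for polynomials of degree $2n+1$), and $\mathcal{Q}_{-1}=0$. Let $\triangle_n=\mathcal{Q}_n-\mathcal{Q}_{n-1}$, and for $\boldsymbol\nu\in\mathcal{F}$ let $\triangle_{\boldsymbol\nu}=\bigotimes_{j\ge1}\triangle_{\nu_j}$,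 where $\triangle_{\nu_j}$ acts on the variable $\xi_j$ (for $\nu_j=0$ this is evaluation at $\xi_j=0$). For a finite admissible set $\Lambda$, $\mathcal{Q}_\Lambda(g)=\sum_{\boldsymbol\nu\in\Lambda}\triangle_{\boldsymbol\nu}(g)$. *)

theory Defs
  imports "HOL-Probability.Probability" "HOL-Computational_Algebra.Polynomial"
begin

text \<open>
  Hilbert spaces are types of sort \<open>{real_inner, banach, polish_space}\<close> (complete and separable).
  All sequences, multi-indices and vectors \<open>\<xi>\<close> are indexed from 0, so the index \<open>j \<ge> 1\<close> of the
  mathematical text is \<open>Suc j\<close> here.
\<close>

section \<open>Unbounded operators on a Hilbert space\<close>

definition orthonormal_basis :: "(nat \<Rightarrow> 'x::real_inner) \<Rightarrow> bool" where
  "orthonormal_basis \<psi> \<longleftrightarrow>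
     (\<forall>i j. \<psi> i \<bullet> \<psi> j = (if i = j then 1 else 0)) \<and> closure (span (range \<psi>)) = UNIV"

text \<open>
  A possibly unbounded operator is a pair of a domain \<open>D\<close> and a function \<open>A\<close> whose values outside
  \<open>D\<close> are irrelevant. The last conjunct says that the graph of the Hilbert space adjoint of
  \<open>(D, A)\<close> coincides with the graph of \<open>(D, A)\<close>; in particular the domains agree.
\<close>

definition self_adjoint_op :: "'x::real_inner set \<Rightarrow> ('x \<Rightarrow> 'x) \<Rightarrow> bool" where
  "self_adjoint_op D A \<longleftrightarrow>
     subspace D \<and> closure D = UNIV \<and>
     (\<forall>x\<in>D. \<forall>y\<in>D. A (x + y) = A x + A y) \<and> (\<forall>c. \<forall>x\<in>D. A (c *\<^sub>R x) = c *\<^sub>R A x) \<and>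
     {(y, z). \<forall>x\<in>D. A x \<bullet> y = x \<bullet> z} = {(y, A y) | y. y \<in> D}"

definition pos_def_op :: "'x::real_inner set \<Rightarrow> ('x \<Rightarrow> 'x) \<Rightarrow> bool" where
  "pos_def_op D A \<longleftrightarrow> (\<forall>x\<in>D. x \<noteq> 0 \<longrightarrow> A x \<bullet> x > 0)"

definition boundedly_invertible_op :: "'x::real_inner set \<Rightarrow> ('x \<Rightarrow> 'x) \<Rightarrow> bool" where
  "boundedly_invertible_op D A \<longleftrightarrow> bij_betw A D UNIV \<and> bounded_linear (inv_into D A)"

definition laplacian_like ::
  "nat \<Rightarrow> 'x::{real_inner, banach, polish_space} set \<Rightarrow> ('x \<Rightarrow> 'x)
    \<Rightarrow> (nat \<Rightarrow> real) \<Rightarrow> (nat \<Rightarrow> 'x) \<Rightarrow> bool" where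
  "laplacian_like d D A lam \<psi> \<longleftrightarrow>
     self_adjoint_op D A \<and> pos_def_op D A \<and> boundedly_invertible_op D A \<and>
     orthonormal_basis \<psi> \<and> (\<forall>j. \<psi> j \<in> D \<and> A (\<psi> j) = lam j *\<^sub>R \<psi> j) \<and> incseq lam \<and>
     (\<exists>c>0. \<exists>C>0. \<forall>j. c * real (Suc j) powr (2 / real d) \<le> lam j \<and>
                        lam j \<le> C * real (Suc j) powr (2 / real d))"

text \<open>
  The power \<open>A\<^sup>p\<close> of the operator with eigenpairs \<open>(lam, \<psi>)\<close>; it is only used with \<open>p < 0\<close> and
  eigenvalues bounded away from 0, where it is defined on the whole space.
\<close>

definition spectral_power ::
  "(nat \<Rightarrow> real) \<Rightarrow> (nat \<Rightarrow> 'x::real_inner) \<Rightarrow> real \<Rightarrow> 'x \<Rightarrow> 'x" where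
  "spectral_power lam \<psi> p x = (\<Sum>j. (lam j powr p * (x \<bullet> \<psi> j)) *\<^sub>R \<psi> j)"

section \<open>Linear Gaussian inverse problem\<close>

text \<open>
  In the next two definitions \<open>C\<^sub>0\<close> and \<open>S = C\<^sub>0\<close> to the power 1/2 are injective but not surjective:
  their inverses are the unbounded operators \<open>inv C\<^sub>0\<close> and \<open>inv S\<close>, with domains \<open>range C\<^sub>0\<close>
  and \<open>range S\<close> (the latter is the Cameron-Martin space).
\<close>

definition posterior_cov ::
  "('x::real_inner \<Rightarrow> 'y::real_inner) \<Rightarrow> ('y \<Rightarrow> 'y) \<Rightarrow> ('x \<Rightarrow> 'x) \<Rightarrow> 'x \<Rightarrow> 'x" where
  "posterior_cov G \<Gamma> C\<^sub>0 = inv_into (range C\<^sub>0) (\<lambda>x. adjoint G (inv \<Gamma> (G x)) + inv C\<^sub>0 x)"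

definition map_functional ::
  "('x::real_inner \<Rightarrow> 'y::real_inner) \<Rightarrow> ('y \<Rightarrow> 'y) \<Rightarrow> 'y \<Rightarrow> ('x \<Rightarrow> 'x) \<Rightarrow> 'x \<Rightarrow> 'x \<Rightarrow> real" where
  "map_functional G \<Gamma> y S m\<^sub>0 m =
     1/2 * ((y - G m) \<bullet> inv \<Gamma> (y - G m)) + 1/2 * (norm (inv S (m - m\<^sub>0)))\<^sup>2"

text \<open>
  The penalty term is finite exactly for \<open>m\<close> in the Cameron-Martin space shifted by the mean
  \<open>m\<^sub>0\<close>, so the minimization runs over that affine space. It is the Cameron-Martin space itself
  if \<open>m\<^sub>0\<close> belongs to it.
\<close>

definition is_map_point ::
  "('x::real_inner \<Rightarrow> 'y::real_inner) \<Rightarrow> ('y \<Rightarrow> 'y) \<Rightarrow> 'y \<Rightarrow> ('x \<Rightarrow> 'x) \<Rightarrow> 'x \<Rightarrow> 'x \<Rightarrow> bool" where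
  "is_map_point G \<Gamma> y S m\<^sub>0 m\<^sub>1 \<longleftrightarrow>
     is_arg_min (map_functional G \<Gamma> y S m\<^sub>0) (\<lambda>m. m - m\<^sub>0 \<in> range S) m\<^sub>1"

definition kl_expansion ::
  "'x::real_inner \<Rightarrow> (nat \<Rightarrow> real) \<Rightarrow> (nat \<Rightarrow> 'x) \<Rightarrow> (nat \<Rightarrow> real) \<Rightarrow> 'x" where
  "kl_expansion m lam \<psi> \<xi> = m + (\<Sum>j. (sqrt (lam j) * \<xi> j) *\<^sub>R \<psi> j)"

definition std_gauss :: "real measure" where
  "std_gauss = density lborel (\<lambda>x. ennreal (std_normal_density x))"

definition gauss_product :: "(nat \<Rightarrow> real) measure" where
  "gauss_product = (\<Pi>\<^sub>M j\<in>UNIV. std_gauss)"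

section \<open>Multi-indices and weights\<close>

definition multi_indices :: "(nat \<Rightarrow> nat) set" where
  "multi_indices = {\<nu>. finite {j. \<nu> j \<noteq> 0}}"

definition admissible :: "(nat \<Rightarrow> nat) set \<Rightarrow> bool" where
  "admissible \<Lambda> \<longleftrightarrow> \<Lambda> \<subseteq> multi_indices \<and>
     (\<forall>\<nu>\<in>\<Lambda>. \<forall>\<mu>\<in>multi_indices. (\<forall>j. \<mu> j \<le> \<nu> j) \<longrightarrow> \<mu> \<in> \<Lambda>)"

text \<open>
  Products over all \<open>j\<close> are taken over the finite support of \<open>\<mu>\<close>; the other factors are 1. For
  fixed \<open>\<nu>\<close> only the finitely many \<open>\<mu> \<le> \<nu>\<close> contribute to the sum, but its index set is infinite.
\<close>

definition multi_weight :: "nat \<Rightarrow> (nat \<Rightarrow> real) \<Rightarrow> (nat \<Rightarrow> nat) \<Rightarrow> real" where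
  "multi_weight r \<tau> \<nu> =
     (\<Sum>\<^sub>\<infinity>\<mu>\<in>{\<mu>\<in>multi_indices. Max (range \<mu>) \<le> r}.
        (\<Prod>j\<in>{j. \<mu> j \<noteq> 0}. real (\<nu> j choose \<mu> j)) * (\<Prod>j\<in>{j. \<mu> j \<noteq> 0}. \<tau> j ^ (2 * \<mu> j)))"

definition weight_order :: "real \<Rightarrow> nat" where
  "weight_order q = (LEAST r. real r > 14 / q)"

definition smallest_indices :: "((nat \<Rightarrow> nat) \<Rightarrow> real) \<Rightarrow> nat \<Rightarrow> (nat \<Rightarrow> nat) set \<Rightarrow> bool" where
  "smallest_indices b N \<Lambda> \<longleftrightarrow> \<Lambda> \<subseteq> multi_indices \<and> finite \<Lambda> \<and> card \<Lambda> = N \<and>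
     (\<forall>\<nu>\<in>\<Lambda>. \<forall>\<mu>\<in>multi_indices - \<Lambda>. b \<nu> \<le> b \<mu>)"

section \<open>Sparse Gauss-Hermite quadrature\<close>

text \<open>Probabilists' Hermite polynomials, orthogonal with respect to \<open>std_gauss\<close>.\<close>

fun hermite_poly :: "nat \<Rightarrow> real poly" where
  "hermite_poly 0 = 1"
| "hermite_poly (Suc 0) = [:0, 1:]"
| "hermite_poly (Suc (Suc n)) =
     [:0, 1:] * hermite_poly (Suc n) - smult (real (Suc n)) (hermite_poly n)"

definition gh_nodes :: "nat \<Rightarrow> real set" where
  "gh_nodes n = {x. poly (hermite_poly (Suc n)) x = 0}"

text \<open>The weight at a node is the Gaussian integral of the Lagrange basis polynomial of that node.\<close>

definition gh_weight :: "nat \<Rightarrow> real \<Rightarrow> real" where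
  "gh_weight n x = (\<integral>t. (\<Prod>z\<in>gh_nodes n - {x}. (t - z) / (x - z)) \<partial>std_gauss)"

definition gauss_hermite :: "nat \<Rightarrow> (real \<Rightarrow> real) \<Rightarrow> real" where
  "gauss_hermite n g = (\<Sum>x\<in>gh_nodes n. gh_weight n x * g x)"

text \<open>The case \<open>n = 0\<close> uses the convention that the quadrature of index -1 is 0.\<close>

definition gh_difference :: "nat \<Rightarrow> (real \<Rightarrow> real) \<Rightarrow> real" where
  "gh_difference n g = (case n of 0 \<Rightarrow> gauss_hermite 0 g
                        | Suc n' \<Rightarrow> gauss_hermite (Suc n') g - gauss_hermite n' g)"

text \<open>
  \<open>partial_tensor \<nu> m g \<xi>\<close> applies the difference operators of orders \<open>\<nu> 0, \<dots>, \<nu> (m - 1)\<close> to the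
  first \<open>m\<close> variables of \<open>g\<close> and evaluates the remaining ones at \<open>\<xi>\<close>. As \<open>gh_difference 0\<close> is
  evaluation at 0, the infinite tensor product is obtained from any \<open>m\<close> beyond the support of \<open>\<nu>\<close>
  by setting the remaining variables to 0.
\<close>

primrec partial_tensor ::
  "(nat \<Rightarrow> nat) \<Rightarrow> nat \<Rightarrow> ((nat \<Rightarrow> real) \<Rightarrow> real) \<Rightarrow> (nat \<Rightarrow> real) \<Rightarrow> real" where
  "partial_tensor \<nu> 0 g \<xi> = g \<xi>"
| "partial_tensor \<nu> (Suc m) g \<xi> =
     gh_difference (\<nu> m) (\<lambda>t. partial_tensor \<nu> m g (\<xi>(m := t)))"

definition tensor_difference :: "(nat \<Rightarrow> nat) \<Rightarrow> ((nat \<Rightarrow> real) \<Rightarrow> real) \<Rightarrow> real" where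
  "tensor_difference \<nu> g = partial_tensor \<nu> (LEAST m. \<forall>j\<ge>m. \<nu> j = 0) g (\<lambda>_. 0)"

definition sparse_quadrature :: "(nat \<Rightarrow> nat) set \<Rightarrow> ((nat \<Rightarrow> real) \<Rightarrow> real) \<Rightarrow> real" where
  "sparse_quadrature \<Lambda> g = (\<Sum>\<nu>\<in>\<Lambda>. tensor_difference \<nu> g)"

end

theory Submission
  imports Defs
begin

text \<open>
  Along the posterior Karhunen-Loeve expansion the integrand is \<open>g \<xi> = h (c + (\<Sum>j. a j * \<xi> j))\<close>
  with the polynomial \<open>h x = x ^ k\<close>, \<open>c = f m\<^sub>1\<close> and \<open>a j = sqrt (lam\<^sub>1 j) * f (\<psi>\<^sub>1 j)\<close>. Functions of
  this shape are stable under everything that is done to a single variable: an operation on \<open>\<xi> j\<close>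
  only replaces \<open>h\<close> by another polynomial. Integrating \<open>\<xi> j\<close> out applies the heat operator
  \<open>exp ((a j)\<^sup>2 * \<partial>\<^sup>2 / 2)\<close>, and the quadrature difference of order \<open>n\<close> applies a differential operator
  \<open>difference_op n (a j)\<close> with constant coefficients. Because a Gauss-Hermite rule with \<open>n + 1\<close> points
  is exact up to degree \<open>2 * n + 1\<close> (\<open>gauss_hermite_exact\<close>), this operator starts with the derivative of order
  \<open>2 * n\<close> and is therefore of size \<open>(a j) ^ (2 * n)\<close>, while the sum over all \<open>n\<close> is the heat operator.
  Consequently the exact mean is the sum of all tensor differences
  (\<open>sum_iterated_difference\<close>, \<open>integral_gauss_series\<close>), the quadrature error is at most the sum of
  \<open>\<bar>tensor_difference \<nu> g\<bar>\<close> over the omitted indices, and each such term is bounded by a constant times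
  \<open>\<Prod>j. (C * (a j)\<^sup>2) ^ \<nu> j\<close>.

  The weights \<open>b \<nu>\<close> are products over the coordinates. Two estimates on the factors settle the rest.
  They are at most \<open>(1 + (\<tau> j)\<^sup>2) ^ \<nu> j\<close>, so the sum of \<open>b \<nu> * \<bar>tensor_difference \<nu> g\<bar>\<close> is finite as soon as
  \<open>\<Sum>j. (1 + (\<tau> j)\<^sup>2) * (a j)\<^sup>2\<close> is (\<open>sparse_quadrature_error_bound\<close>). They grow fast enough for
  \<open>b \<nu> powr - (q / 2)\<close> to be summable over all multi-indices, so outside the \<open>N\<close> smallest weights
  \<open>b \<nu>\<close> is at least of order \<open>N powr (2 / q)\<close> (\<open>smallest_indices_multi_weight\<close>). Together the error is
  \<open>O(N powr - (2 / q))\<close>.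

  It remains to see how large \<open>\<tau>\<close> may be. The posterior precision exceeds the prior precision by the
  positive operator \<open>G\<^sup>* \<Gamma>\<^sup>-\<^sup>1 G\<close>, hence by the min-max principle \<open>lam\<^sub>1 j\<close> is at most the prior
  eigenvalue, of order \<open>j powr - (2 * \<alpha> / d)\<close> (\<open>posterior_eigenvalue_bound\<close>). Moreover
  \<open>f (\<psi>\<^sub>1 j)\<close> is square summable by Bessel's inequality. With \<open>\<rho> = \<alpha> / d > 1\<close> the choice
  \<open>\<tau> j = j powr \<rho>\<close> therefore meets this condition, and \<open>q = 2 / (1 + \<rho>)\<close> lies in the interval from \<open>1 / \<rho>\<close>
  to 1 and gives the rate \<open>2 / q = 1 + \<rho> > s\<close>. For \<open>\<rho> \<le> 1\<close> the exponent \<open>s\<close> is negative and it suffices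
  that the error is bounded (\<open>sparse_quadrature_rate\<close>).
\<close>

section \<open>Gaussian moments and Gauss-Hermite exactness\<close>

lemma prob_space_std_gauss: "prob_space std_gauss"
  unfolding std_gauss_def by (rule prob_space_normal_density) simp

lemma sets_std_gauss [measurable_cong, simp]: "sets std_gauss = sets borel"
  by (simp add: std_gauss_def)

lemma space_std_gauss [simp]: "space std_gauss = UNIV"
  by (simp add: std_gauss_def)

lemma std_gauss_power_integrable: "integrable std_gauss (\<lambda>x. x ^ i)"
  unfolding std_gauss_def
  by (subst integrable_density) (auto simp: integrable_std_normal_moment)

lemma std_gauss_integrable_poly: "integrable std_gauss (\<lambda>x. poly p x)"
  unfolding poly_altdef by (intro Bochner_Integration.integrable_sum integrable_mult_right std_gauss_power_integrable)

definition gauss_moment :: "nat \<Rightarrow> real" where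
  "gauss_moment i = (\<integral>x. x ^ i \<partial>std_gauss)"

lemma gauss_moment_even: "gauss_moment (2 * n) = fact (2 * n) / (2 ^ n * fact n)"
  unfolding gauss_moment_def std_gauss_def
  by (subst integral_density) (auto simp: integral_std_normal_moment_even)

lemma gauss_moment_odd: "gauss_moment (2 * n + 1) = 0"
  unfolding gauss_moment_def std_gauss_def
  using integral_std_normal_moment_odd[of n] by (subst integral_density) auto

definition gauss_mean :: "real poly \<Rightarrow> real" where
  "gauss_mean p = (\<integral>x. poly p x \<partial>std_gauss)"

lemma gauss_mean_congI: "(\<And>x. poly p x = g x) \<Longrightarrow> gauss_mean p = (\<integral>x. g x \<partial>std_gauss)"
  unfolding gauss_mean_def by (rule Bochner_Integration.integral_cong) auto

lemma gauss_mean_add: "gauss_mean (p + q) = gauss_mean p + gauss_mean q"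
  and gauss_mean_diff: "gauss_mean (p - q) = gauss_mean p - gauss_mean q"
  and gauss_mean_smult: "gauss_mean (smult c p) = c * gauss_mean p"
  by (subst gauss_mean_congI, simp, simp add: gauss_mean_def std_gauss_integrable_poly[simplified])+

lemma gauss_mean_sum: "gauss_mean (\<Sum>i\<in>S. p i) = (\<Sum>i\<in>S. gauss_mean (p i))"
  by (subst gauss_mean_congI[OF poly_sum])
     (simp add: gauss_mean_def std_gauss_integrable_poly[simplified])

lemma gauss_mean_monom: "gauss_mean (monom c i) = c * gauss_moment i"
  by (subst gauss_mean_congI[OF poly_monom]) (simp add: gauss_moment_def)

lemma gauss_moment_Suc: "gauss_moment (Suc i) = real i * gauss_moment (i - 1)"
proof (cases "even i")
  case True
  then obtain n where i: "i = 2 * n" by auto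
  show ?thesis
  proof (cases n)
    case 0 then show ?thesis using i gauss_moment_odd[of 0] by simp
  next
    case (Suc m)
    then have "i - 1 = 2 * m + 1" using i by simp
    then show ?thesis using i gauss_moment_odd[of n] gauss_moment_odd[of m] by simp
  qed
next
  case False
  then obtain n where i: "i = 2 * n + 1" by (auto elim: oddE)
  have "gauss_moment (2 * Suc n) = real (2 * n + 1) * gauss_moment (2 * n)"
  proof -
    have "fact (2 * Suc n) / (2 ^ Suc n * fact (Suc n))
        = (2 * real (Suc n) * (real (2 * n + 1) * fact (2 * n))) / (2 * real (Suc n) * (2 ^ n * fact n))"
      by (simp add: algebra_simps)
    also have "\<dots> = real (2 * n + 1) * (fact (2 * n) / (2 ^ n * fact n))"
      by (subst mult_divide_mult_cancel_left) auto
    finally show ?thesis unfolding gauss_moment_even .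
  qed
  then show ?thesis using i by simp
qed

lemma pderiv_sum: "pderiv (\<Sum>i\<in>S. p i) = (\<Sum>i\<in>S. pderiv (p i))"
  by (induction S rule: infinite_finite_induct) (simp_all add: pderiv_add)

text \<open>
  Integration by parts against the Gaussian density. On monomials it is the recursion of the moments,
  so no boundary terms have to be discussed.
\<close>

lemma gauss_mean_stein: "gauss_mean ([:0, 1:] * p) = gauss_mean (pderiv p)"
proof -
  have *: "gauss_mean ([:0, 1:] * monom c i) = gauss_mean (pderiv (monom c i))" for c i
  proof -
    have "[:0, 1:] * monom c i = monom c (Suc i)"
      by (simp add: monom_Suc)
    then show ?thesis by (simp add: gauss_mean_monom pderiv_monom gauss_moment_Suc)
  qed
  have "gauss_mean ([:0, 1:] * (\<Sum>i\<le>degree p. monom (coeff p i) i))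
      = gauss_mean (pderiv (\<Sum>i\<le>degree p. monom (coeff p i) i))"
    unfolding sum_distrib_left pderiv_sum gauss_mean_sum * ..
  then show ?thesis by (simp add: poly_as_sum_of_monoms)
qed

lemma gauss_mean_pos:
  assumes "\<And>x. 0 \<le> poly p x" "p \<noteq> 0"
  shows "0 < gauss_mean p"
proof (rule ccontr)
  assume "\<not> 0 < gauss_mean p"
  moreover have "0 \<le> gauss_mean p" unfolding gauss_mean_def using assms by simp
  ultimately have "(\<integral>x. poly p x \<partial>std_gauss) = 0" by (simp add: gauss_mean_def)
  then have "AE x in std_gauss. poly p x = 0"
    by (subst (asm) integral_nonneg_eq_0_iff_AE) (auto simp: assms std_gauss_integrable_poly)
  then have "AE x in lborel. poly p x = 0"
    unfolding std_gauss_def by (subst (asm) AE_density) (auto simp: normal_density_pos)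
  moreover have "AE x in lborel. poly p x \<noteq> 0"
    using finite_imp_null_set_lborel[OF poly_roots_finite[OF assms(2)]]
    by (rule AE_I') auto
  ultimately have "AE x in (lborel :: real measure). False" by eventually_elim auto
  then show False by (simp add: AE_iff_null null_sets_def)
qed

lemma degree_hermite_poly: "degree (hermite_poly n) = n \<and> lead_coeff (hermite_poly n) = 1"
proof (induction n rule: hermite_poly.induct)
  case (3 n)
  define p q where "p = [:0, 1:] * hermite_poly (Suc n)" and "q = smult (real (Suc n)) (hermite_poly n)"
  have nz: "hermite_poly (Suc n) \<noteq> 0" using 3 by auto
  have p: "degree p = Suc (Suc n)" "lead_coeff p = 1"
    using 3 nz unfolding p_def lead_coeff_mult by (auto simp add: degree_mult_eq simp del: mult_pCons_left)
  have q: "degree q < degree p" using 3 p unfolding q_def by (simp add: le_imp_less_Suc)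
  have "degree (p - q) = degree p" using q by (metis degree_add_eq_left degree_minus diff_conv_add_uminus)
  moreover have "lead_coeff (p - q) = 1" using p q calculation
    by (simp add: coeff_eq_0)
  ultimately show ?case using p by (simp add: p_def q_def)
qed auto

lemma pderiv_hermite_poly: "pderiv (hermite_poly (Suc n)) = smult (real (Suc n)) (hermite_poly n)"
proof (induction n rule: less_induct)
  case (less n)
  show ?case
  proof (cases n)
    case 0 then show ?thesis by (simp add: pderiv_pCons)
  next
    case (Suc m)
    have d: "pderiv (hermite_poly m * [:0,1:]) = 
       hermite_poly m + [:0,1:] * pderiv (hermite_poly m)" for m
      by (simp add: pderiv_mult pderiv_pCons)
    have IH: "pderiv (hermite_poly (Suc m)) = smult (real (Suc m)) (hermite_poly m)"
      using less[of m] Suc by simp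
    have IH2: "pderiv (hermite_poly m) = smult (real m) (hermite_poly (m - 1))"
    proof (cases m)
      case (Suc l) then show ?thesis using less[of l] \<open>n = Suc m\<close> by simp
    qed simp
    have rec: "[:0,1:] * hermite_poly m - smult (real m) (hermite_poly (m - 1)) = hermite_poly (Suc m)"
      by (cases m) (simp_all)
    have "pderiv (hermite_poly (Suc (Suc m))) = hermite_poly (Suc m)
        + [:0,1:] * smult (real (Suc m)) (hermite_poly m)
        - smult (real (Suc m)) (smult (real m) (hermite_poly (m - 1)))"
      unfolding hermite_poly.simps pderiv_diff pderiv_smult IH2
      by (simp only: mult.commute[of "[:0,1:]" "hermite_poly (Suc m)"] d IH)
    also have "\<dots> = hermite_poly (Suc m) + smult (real (Suc m))
        ([:0,1:] * hermite_poly m - smult (real m) (hermite_poly (m - 1)))"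
      by (simp only: smult_diff_right mult_smult_right add_diff_eq)
    also have "\<dots> = smult (real (Suc (Suc m))) (hermite_poly (Suc m))"
      unfolding rec by (metis (no_types) of_nat_Suc smult_1_left smult_add_left)
    finally show ?thesis using Suc by simp
  qed
qed

text \<open>
  The three-term recurrence and the derivative rule for Hermite polynomials combine, through
  integration by parts, to the algebraic form of Rodrigues' formula: a Hermite polynomial of order
  \<open>n\<close> integrates \<open>p\<close> like the \<open>n\<close>-th derivative of \<open>p\<close>. Orthogonality to lower degrees is immediate.
\<close>

lemma gauss_mean_hermite_Suc:
  "gauss_mean (hermite_poly (Suc n) * p) = gauss_mean (hermite_poly n * pderiv p)"
proof (cases n)
  case 0 then show ?thesis using gauss_mean_stein[of p] by simp
next
  case (Suc m)
  have "hermite_poly (Suc n) * p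
      = [:0,1:] * (hermite_poly n * p) - smult (real n) (hermite_poly m * p)"
    using Suc by (simp add: algebra_simps)
  then have "gauss_mean (hermite_poly (Suc n) * p) =
     gauss_mean (pderiv (hermite_poly n * p)) - real n * gauss_mean (hermite_poly m * p)"
    by (simp only: gauss_mean_diff gauss_mean_stein gauss_mean_smult)
  also have "pderiv (hermite_poly n * p) = hermite_poly n * pderiv p + smult (real n) (hermite_poly m * p)"
    using Suc pderiv_hermite_poly[of m] by (simp add: pderiv_mult mult.commute)
  finally show ?thesis by (simp add: gauss_mean_add gauss_mean_smult)
qed

lemma gauss_mean_hermite_orthogonal:
  "degree p < n \<Longrightarrow> gauss_mean (hermite_poly n * p) = 0"
proof (induction n arbitrary: p)
  case (Suc n)
  show ?case
  proof (cases "pderiv p = 0")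
    case True then show ?thesis unfolding gauss_mean_hermite_Suc by (simp add: gauss_mean_def)
  next
    case False
    then have "degree (pderiv p) < n" using Suc.prems degree_pderiv[of p] pderiv_eq_0_iff[of p] by simp
    then show ?thesis unfolding gauss_mean_hermite_Suc using Suc.IH by simp
  qed
qed simp

lemma poly_no_root_sign:
  fixes p :: "real poly"
  assumes "\<And>x. poly p x \<noteq> 0"
  shows "(\<forall>x. poly p x > 0) \<or> (\<forall>x. poly p x < 0)"
proof (rule ccontr)
  assume "\<not> ?thesis"
  then obtain x y where "poly p x < 0" "poly p y > 0" using assms by (meson linorder_neqE_linordered_idom)
  then show False
    using poly_IVT_pos[of x y p] poly_IVT_neg[of y x p] assms by (metis linorder_neqE_linordered_idom less_asym)
qed

lemma prod_linear_factors_dvd: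
  fixes p :: "'a::idom poly"
  assumes "finite S" "\<And>z. z \<in> S \<Longrightarrow> poly p z = 0"
  shows "(\<Prod>z\<in>S. [:-z, 1:]) dvd p"
  using assms
proof (induction S)
  case (insert w S)
  then obtain r where r: "p = (\<Prod>z\<in>S. [:-z, 1:]) * r" by (auto elim: dvdE)
  have "poly (\<Prod>z\<in>S. [:-z, 1:]) w \<noteq> 0"
    using insert.hyps by (auto simp: poly_prod)
  then have "poly r w = 0" using insert.prems[of w] r by simp
  then have "[:-w, 1:] dvd r" by (simp add: poly_eq_0_iff_dvd)
  then show ?case using insert.hyps r by (simp add: mult.commute[of r] mult_dvd_mono del: mult_pCons_left)
qed simp

text \<open>
  The classical argument from orthogonality. If \<open>x\<close> were a multiple root, division by the square of
  its linear factor would give a polynomial of lower degree whose product with the Hermite polynomial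
  is a square. If there were too few real roots, the product with the linear factors of the
  existing ones would have constant sign. Both products have a nonzero mean.
\<close>

lemma card_hermite_roots: "card {x. poly (hermite_poly n) x = 0} = n"
proof -
  define H where "H = hermite_poly n"
  define Z where "Z = {x. poly H x = 0}"
  have H: "H \<noteq> 0" "degree H = n" using degree_hermite_poly[of n] by (auto simp: H_def)
  have fin: "finite Z" unfolding Z_def by (rule poly_roots_finite[OF H(1)])
  have le: "card Z \<le> n" using card_poly_roots_bound[OF H(1)] H by (simp add: Z_def)
  define P where "P = (\<Prod>z\<in>Z. [:-z, 1:])"
  have degP: "degree P = card Z" unfolding P_def
    by (subst degree_prod_eq_sum_degree) auto
  have "(\<Prod>z\<in>Z. [:-z, 1:]) dvd H"
    by (rule prod_linear_factors_dvd[OF fin]) (simp add: Z_def)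
  then obtain R where R: "H = P * R" unfolding P_def by (elim dvdE)
  have Rnz: "R \<noteq> 0" "P \<noteq> 0" using R H by auto
  have "poly R x \<noteq> 0" for x
  proof
    assume "poly R x = 0"
    then obtain R' where R': "R = [:-x, 1:] * R'" unfolding poly_eq_0_iff_dvd by (elim dvdE)
    have "x \<in> Z" using \<open>poly R x = 0\<close> R by (simp add: Z_def)
    then obtain P' where P': "P = [:-x, 1:] * P'" unfolding P_def using fin by (metis dvd_def dvd_prodI)
    define S where "S = P' * R'"
    have HS: "H = [:-x, 1:] * [:-x, 1:] * S" unfolding R R' P' S_def by (simp only: mult_ac)
    then have Snz: "S \<noteq> 0" using H by auto
    then have "degree H = degree S + 2" unfolding HS by (subst degree_mult_eq) (auto simp: degree_mult_eq)
    then have "gauss_mean (H * S) = 0" unfolding H_def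
      by (intro gauss_mean_hermite_orthogonal) (use H in \<open>simp add: H_def\<close>)
    moreover have "0 < gauss_mean (H * S)"
    proof (rule gauss_mean_pos)
      have "poly (H * S) t = ((t - x) * poly S t)\<^sup>2" for t
        unfolding HS by (simp add: power2_eq_square algebra_simps)
      then show "0 \<le> poly (H * S) t" for t by simp
    qed (use H Snz in auto)
    ultimately show False by simp
  qed
  then have sgn: "(\<forall>x. poly R x > 0) \<or> (\<forall>x. poly R x < 0)" by (rule poly_no_root_sign)
  have "\<not> card Z < n"
  proof
    assume "card Z < n"
    then have 0: "gauss_mean (H * P) = 0" unfolding H_def
      by (intro gauss_mean_hermite_orthogonal) (simp add: degP)
    have eq: "poly (H * P) t = (poly P t)\<^sup>2 * poly R t" for t
      unfolding R by (simp add: power2_eq_square algebra_simps)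
    from sgn show False
    proof
      assume "\<forall>x. poly R x > 0"
      then have "0 < gauss_mean (H * P)" using Rnz H
        by (intro gauss_mean_pos) (auto simp: eq less_imp_le simp del: poly_mult)
      with 0 show False by simp
    next
      assume "\<forall>x. poly R x < 0"
      then have "0 < gauss_mean (smult (-1) (H * P))" using Rnz H
        by (intro gauss_mean_pos) (auto simp: eq less_imp_le mult_nonneg_nonpos simp del: smult_minus_left poly_mult)
      with 0 show False unfolding gauss_mean_smult by simp
    qed
  qed
  with le show ?thesis by (simp add: Z_def H_def)
qed

lemma finite_gh_nodes: "finite (gh_nodes n)" and card_gh_nodes: "card (gh_nodes n) = Suc n"
proof -
  show "card (gh_nodes n) = Suc n" unfolding gh_nodes_def by (rule card_hermite_roots)
  then show "finite (gh_nodes n)" by (metis card.infinite nat.distinct(1))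
qed

text \<open>
  Gauss quadrature gains half of its degree from orthogonality: after division by the polynomial that
  vanishes at the nodes, the quotient contributes neither to the integral (orthogonality) nor to the
  rule (the nodes are roots), and the remainder is reproduced by interpolation at the \<open>n + 1\<close> nodes.
\<close>

lemma gauss_hermite_exact:
  assumes "degree p \<le> 2 * n + 1"
  shows "gauss_hermite n (poly p) = gauss_mean p"
proof -
  define H where "H = hermite_poly (Suc n)"
  have H: "H \<noteq> 0" "degree H = Suc n" using degree_hermite_poly[of "Suc n"] by (auto simp: H_def)
  define L where "L x = (\<Prod>z\<in>gh_nodes n - {x}. smult (1 / (x - z)) [:-z, 1:])" for x
  have L: "poly (L x) t = (\<Prod>z\<in>gh_nodes n - {x}. (t - z) / (x - z))" for x t
    by (simp add: L_def poly_prod diff_divide_distrib)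
  have w: "gh_weight n x = gauss_mean (L x)" for x
    by (simp add: gh_weight_def gauss_mean_def L)
  have Lx: "poly (L x) x = 1" for x by (auto simp: L intro!: prod.neutral)
  have Ly: "poly (L x) y = 0" if "y \<in> gh_nodes n" "y \<noteq> x" for x y
    unfolding L using that finite_gh_nodes by (auto intro!: prod_zero)
  have degL: "degree (L x) \<le> n" if "x \<in> gh_nodes n" for x
  proof -
    have "degree (L x) \<le> (\<Sum>z\<in>gh_nodes n - {x}. degree (smult (1 / (x - z)) [:-z, 1:]))"
      unfolding L_def using finite_gh_nodes by (intro degree_prod_sum_le[THEN order_trans]) (auto simp: o_def)
    also have "\<dots> \<le> (\<Sum>z\<in>gh_nodes n - {x}. 1)" by (intro sum_mono) simp
    also have "\<dots> = n" using that finite_gh_nodes[of n] by (simp add: card_gh_nodes)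
    finally show ?thesis .
  qed
  define r q where "r = p mod H" and "q = p div H"
  have p: "p = H * q + r" by (simp add: r_def q_def)
  have degr: "degree r \<le> n" using degree_mod_less'[of H p] H
    by (cases "r = 0") (auto simp: r_def)
  have degq: "degree q < Suc n"
  proof (cases "q = 0")
    case False
    have "degree (H * q) \<le> 2 * n + 1"
      using degree_diff_le[of p "2*n+1" r] assms degr p by (simp add: add_diff_eq)
    then show ?thesis using False H by (simp add: degree_mult_eq)
  qed simp
  have interp: "r = (\<Sum>x\<in>gh_nodes n. smult (poly r x) (L x))" (is "r = ?s")
  proof (rule ccontr)
    assume "r \<noteq> ?s"
    then have nz: "r - ?s \<noteq> 0" by simp
    have "degree ?s \<le> n" by (intro degree_sum_le finite_gh_nodes) (auto intro: degL)
    then have "degree (r - ?s) \<le> n" using degr by (intro degree_diff_le) auto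
    have "gh_nodes n \<subseteq> {x. poly (r - ?s) x = 0}"
    proof
      fix y assume y: "y \<in> gh_nodes n"
      have "poly ?s y = (\<Sum>x\<in>gh_nodes n. if x = y then poly r y else 0)"
        unfolding poly_sum using y by (intro sum.cong) (auto simp: Lx Ly)
      also have "\<dots> = poly r y" using y finite_gh_nodes[of n] by simp
      finally show "y \<in> {x. poly (r - ?s) x = 0}" by simp
    qed
    then have "Suc n \<le> card {x. poly (r - ?s) x = 0}"
      using card_mono[OF poly_roots_finite[OF nz]] card_gh_nodes[of n] by metis
    also have "\<dots> \<le> degree (r - ?s)" by (rule card_poly_roots_bound[OF nz])
    finally show False using \<open>degree (r - ?s) \<le> n\<close> by simp
  qed
  have "gauss_hermite n (poly p) = (\<Sum>x\<in>gh_nodes n. gauss_mean (L x) * poly r x)"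
    unfolding gauss_hermite_def w by (intro sum.cong) (auto simp: p gh_nodes_def H_def)
  also have "\<dots> = gauss_mean r"
    by (subst (2) interp) (simp add: gauss_mean_sum gauss_mean_smult mult.commute)
  also have "\<dots> = gauss_mean p"
    unfolding p gauss_mean_add using gauss_mean_hermite_orthogonal[OF degq] by (simp add: H_def)
  finally show ?thesis .
qed

lemma gauss_hermite_sum:
  "gauss_hermite n (\<lambda>t. \<Sum>i\<in>S. u i * g i t) = (\<Sum>i\<in>S. u i * gauss_hermite n (g i))"
  unfolding gauss_hermite_def sum_distrib_left
  by (subst sum.swap) (simp add: algebra_simps)

lemma gh_difference_sum:
  "gh_difference n (\<lambda>t. \<Sum>i\<in>S. u i * g i t) = (\<Sum>i\<in>S. u i * gh_difference n (g i))"
  unfolding gh_difference_def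
  by (cases n) (simp_all add: gauss_hermite_sum sum_subtractf right_diff_distrib)

lemma gauss_hermite_power:
  assumes "i \<le> 2 * n + 1"
  shows "gauss_hermite n (\<lambda>t. t ^ i) = gauss_moment i"
proof -
  have "(\<lambda>t. t ^ i) = poly (monom (1 :: real) i)" by (simp add: poly_monom fun_eq_iff)
  then show ?thesis using gauss_hermite_exact[of "monom 1 i" n] assms
    by (simp add: degree_monom_eq gauss_mean_monom)
qed

text \<open>
  Through this identity the coordinates outside the support of a multi-index drop out of a tensor
  difference.
\<close>

lemma gauss_hermite_0: "gauss_hermite 0 g = g 0"
proof -
  have "gh_nodes 0 = {0}" by (auto simp: gh_nodes_def)
  moreover have "gauss_hermite 0 (\<lambda>t. t ^ 0) = 1"
    using gauss_hermite_power[of 0 0] gauss_moment_even[of 0] by simp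
  ultimately show ?thesis by (simp add: gauss_hermite_def)
qed

definition gh_diff_moment :: "nat \<Rightarrow> nat \<Rightarrow> real" where
  "gh_diff_moment n i = gh_difference n (\<lambda>t. t ^ i)"

text \<open>
  The rules of index \<open>n\<close> and \<open>n - 1\<close> are both exact on these monomials, so their difference
  vanishes.
\<close>

lemma gh_diff_moment_eq_0: "i < 2 * n \<Longrightarrow> gh_diff_moment n i = 0"
  unfolding gh_diff_moment_def gh_difference_def
  by (cases n) (simp_all add: gauss_hermite_power)

lemma sum_gh_diff_moment:
  assumes "i \<le> 2 * K + 1"
  shows "(\<Sum>n\<le>K. gh_diff_moment n i) = gauss_moment i"
proof -
  have "(\<Sum>n\<le>K. gh_diff_moment n i) = gauss_hermite K (\<lambda>t. t ^ i)"
    unfolding gh_diff_moment_def by (induction K) (simp_all add: gh_difference_def)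
  then show ?thesis using gauss_hermite_power[OF assms] by simp
qed

section \<open>Sums over boxes of multi-indices\<close>

text \<open>
  Finite stand-ins for the set of all multi-indices: every finite set of multi-indices lies in such a
  box, and sums of products over a box factorise.
\<close>

definition index_box :: "nat \<Rightarrow> (nat \<Rightarrow> nat) \<Rightarrow> (nat \<Rightarrow> nat) set" where
  "index_box m K = {\<nu>. (\<forall>j<m. \<nu> j \<le> K j) \<and> (\<forall>j\<ge>m. \<nu> j = 0)}"

lemma index_box_0: "index_box 0 K = {\<lambda>_. 0}"
  by (auto simp: index_box_def)

lemma index_box_Suc:
  "index_box (Suc m) K = (\<lambda>(n, \<nu>). \<nu>(m := n)) ` ({..K m} \<times> index_box m K)"
proof (intro equalityI subsetI)
  fix \<nu> assume \<nu>: "\<nu> \<in> index_box (Suc m) K"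
  then have "(\<nu> m, \<nu>(m := 0)) \<in> {..K m} \<times> index_box m K"
    by (auto simp: index_box_def)
  then show "\<nu> \<in> (\<lambda>(n, \<nu>). \<nu>(m := n)) ` ({..K m} \<times> index_box m K)"
    by (rule rev_image_eqI) simp
qed (auto simp: index_box_def less_Suc_eq)

lemma finite_index_box: "finite (index_box m K)"
  by (induction m) (simp_all add: index_box_0 index_box_Suc)

lemma index_box_multi_indices: "index_box m K \<subseteq> multi_indices"
proof
  fix \<nu> assume "\<nu> \<in> index_box m K"
  then have "{j. \<nu> j \<noteq> 0} \<subseteq> {..<m}" by (auto simp: index_box_def not_less[symmetric])
  then show "\<nu> \<in> multi_indices" unfolding multi_indices_def using finite_subset by auto
qed

lemma sum_index_box_Suc:
  "(\<Sum>\<nu>\<in>index_box (Suc m) K. F \<nu>) = (\<Sum>n\<le>K m. \<Sum>\<nu>\<in>index_box m K. F (\<nu>(m := n)))"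
proof -
  have "inj_on (\<lambda>(n, \<nu>). \<nu>(m := n)) ({..K m} \<times> index_box m K)"
  proof (rule inj_onI, clarify)
    fix n \<nu> n' \<nu>' assume *: "\<nu> \<in> index_box m K" "\<nu>' \<in> index_box m K" "\<nu>(m := n) = \<nu>'(m := n')"
    have "\<nu> j = \<nu>' j" for j
      using fun_cong[OF *(3), of j] *(1,2) by (cases "j = m") (auto simp: index_box_def)
    then show "n = n' \<and> \<nu> = \<nu>'" using fun_cong[OF *(3), of m] by auto
  qed
  then show ?thesis unfolding index_box_Suc
    by (simp add: sum.reindex sum.cartesian_product case_prod_unfold)
qed

lemma sum_prod_index_box:
  fixes f :: "nat \<Rightarrow> nat \<Rightarrow> 'a::comm_semiring_1"
  shows "(\<Sum>\<nu>\<in>index_box m K. \<Prod>j<m. f j (\<nu> j)) = (\<Prod>j<m. \<Sum>n\<le>K j. f j n)"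
proof (induction m)
  case (Suc m)
  have "(\<Sum>\<nu>\<in>index_box (Suc m) K. \<Prod>j<Suc m. f j (\<nu> j))
      = (\<Sum>n\<le>K m. \<Sum>\<nu>\<in>index_box m K. (\<Prod>j<m. f j (\<nu> j)) * f m n)"
    unfolding sum_index_box_Suc by simp
  also have "\<dots> = (\<Prod>j<Suc m. \<Sum>n\<le>K j. f j n)"
    unfolding sum_distrib_right[symmetric] Suc.IH sum_distrib_left[symmetric] by simp
  finally show ?case .
qed (simp add: index_box_0)

section \<open>Quadrature differences as differential operators\<close>

lemma higher_pderiv_eq_0: "degree (h :: real poly) < i \<Longrightarrow> (pderiv ^^ i) h = 0"
proof (cases i)
  case (Suc K)
  assume "degree h < i"
  then have "degree ((pderiv ^^ K) h) = 0" using Suc by (simp add: degree_higher_pderiv)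
  then show ?thesis by (simp add: pderiv_eq_0_iff Suc)
qed simp

lemma poly_taylor:
  fixes h :: "real poly"
  assumes "degree h \<le> K"
  shows "poly h (c + x) = (\<Sum>i\<le>K. poly ((pderiv ^^ i) h) c / fact i * x ^ i)"
proof -
  define D where "D i = (\<lambda>x. poly ((pderiv ^^ i) h) (c + x))" for i
  have "D 0 = (\<lambda>x. poly h (c + x))" by (simp add: D_def)
  moreover have "\<forall>i x. DERIV (D i) x :> D (Suc i) x"
    unfolding D_def by (auto intro!: derivative_eq_intros)
  ultimately obtain t where
    "poly h (c + x) = (\<Sum>i<Suc K. D i 0 / fact i * x ^ i) + D (Suc K) t / fact (Suc K) * x ^ Suc K"
    using Maclaurin_all_le[of D "\<lambda>x. poly h (c + x)" x "Suc K"] by auto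
  moreover have "(pderiv ^^ Suc K) h = 0" using assms by (intro higher_pderiv_eq_0) simp
  ultimately show ?thesis by (simp add: D_def lessThan_Suc_atMost del: funpow.simps)
qed

lemma smult_sum_right: "smult c (\<Sum>i\<in>S. p i) = (\<Sum>i\<in>S. smult c (p i))"
  by (induction S rule: infinite_finite_induct) (simp_all add: smult_add_right)

text \<open>
  The quadrature difference in the variable \<open>t\<close> of \<open>h (x + a * t)\<close>, as a polynomial in \<open>x\<close>: by Taylor's
  formula it is a differential operator with constant coefficients.
\<close>

definition difference_op :: "nat \<Rightarrow> real \<Rightarrow> real poly \<Rightarrow> real poly" where
  "difference_op n a h =
     (\<Sum>i\<le>degree h. smult (gh_diff_moment n i * a ^ i / fact i) ((pderiv ^^ i) h))"

lemma difference_op_upto: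
  assumes "degree h \<le> K"
  shows "difference_op n a h = (\<Sum>i\<le>K. smult (gh_diff_moment n i * a ^ i / fact i) ((pderiv ^^ i) h))"
  unfolding difference_op_def using assms
  by (intro sum.mono_neutral_left) (auto simp: higher_pderiv_eq_0)

lemma poly_difference_op: "poly (difference_op n a h) c = gh_difference n (\<lambda>t. poly h (c + a * t))"
proof -
  have "(\<lambda>t. poly h (c + a * t))
      = (\<lambda>t. \<Sum>i\<le>degree h. (poly ((pderiv ^^ i) h) c / fact i * a ^ i) * t ^ i)"
    by (simp add: poly_taylor[OF order_refl] power_mult_distrib mult.assoc)
  then show ?thesis
    by (simp only: gh_difference_sum gh_diff_moment_def[symmetric])
       (simp add: difference_op_def poly_sum mult_ac)
qed

lemma difference_op_0: "difference_op 0 a h = h"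
  by (simp add: poly_eq_poly_eq_iff[symmetric] fun_eq_iff poly_difference_op gh_difference_def gauss_hermite_0)

lemma degree_difference_op: "degree (difference_op n a h) \<le> degree h"
  unfolding difference_op_def
  by (intro degree_sum_le) (auto intro: order_trans[OF degree_smult_le] simp: degree_higher_pderiv)

text \<open>
  The operator \<open>exp (v * \<partial>\<^sup>2 / 2)\<close> on polynomials. It convolves with the centred Gaussian of variance
  \<open>v\<close>; the series stops because derivatives of high order vanish.
\<close>

definition heat :: "real \<Rightarrow> real poly \<Rightarrow> real poly" where
  "heat v h = (\<Sum>i\<le>degree h. smult ((v / 2) ^ i / fact i) ((pderiv ^^ (2 * i)) h))"

lemma heat_upto:
  assumes "degree h \<le> K"
  shows "heat v h = (\<Sum>i\<le>K. smult ((v / 2) ^ i / fact i) ((pderiv ^^ (2 * i)) h))"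
  unfolding heat_def using assms
  by (intro sum.mono_neutral_left) (auto simp: higher_pderiv_eq_0)

lemma degree_heat: "degree (heat v h) \<le> degree h"
  unfolding heat_def
  by (intro degree_sum_le) (auto intro: order_trans[OF degree_smult_le] simp: degree_higher_pderiv)

lemma heat_zero: "heat 0 h = h"
  unfolding heat_def by (subst sum.atMost_shift) simp

text \<open>
  Odd Gaussian moments vanish and the even ones cancel the factorials of Taylor's formula, which
  turns a sum over all derivatives into the exponential series of the second derivative.
\<close>

lemma gauss_moment_sum:
  fixes L :: nat
  assumes "\<And>i. i > L \<Longrightarrow> p i = 0"
  shows "(\<Sum>i\<le>L. smult (gauss_moment i * a ^ i / fact i) (p i))
       = (\<Sum>i\<le>L. smult ((a\<^sup>2 / 2) ^ i / fact i) (p (2 * i)))"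
proof -
  have eq: "gauss_moment (2 * i) * a ^ (2 * i) / fact (2 * i) = (a\<^sup>2 / 2) ^ i / fact i" for i
    by (simp add: gauss_moment_even power_mult power_divide)
  have "(\<Sum>i\<le>L. smult (gauss_moment i * a ^ i / fact i) (p i))
      = (\<Sum>i\<in>(*) 2 ` {..L}. smult (gauss_moment i * a ^ i / fact i) (p i))"
  proof (rule sum.mono_neutral_cong)
    fix i assume i: "i \<in> {..L} - (*) 2 ` {..L}"
    have "odd i"
    proof
      assume "even i"
      then obtain j where "i = 2 * j" by (elim evenE)
      then show False using i by auto
    qed
    then show "smult (gauss_moment i * a ^ i / fact i) (p i) = 0"
      using gauss_moment_odd by (auto elim!: oddE)
  next
    fix i assume "i \<in> (*) 2 ` {..L} - {..L}"
    then have "i > L" by auto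
    then show "smult (gauss_moment i * a ^ i / fact i) (p i) = 0" using assms by simp
  qed auto
  also have "\<dots> = (\<Sum>i\<le>L. smult (gauss_moment (2 * i) * a ^ (2 * i) / fact (2 * i)) (p (2 * i)))"
    by (subst sum.reindex) (auto intro: inj_onI)
  finally show ?thesis unfolding eq .
qed

lemma heat_eq_moments:
  "heat (a\<^sup>2) h = (\<Sum>i\<le>degree h. smult (gauss_moment i * a ^ i / fact i) ((pderiv ^^ i) h))"
  unfolding heat_def by (subst gauss_moment_sum) (auto simp: higher_pderiv_eq_0)

lemma poly_heat: "poly (heat (a\<^sup>2) h) c = (\<integral>x. poly h (c + a * x) \<partial>std_gauss)"
proof -
  have "(\<integral>x. poly h (c + a * x) \<partial>std_gauss) =
    (\<integral>x. (\<Sum>i\<le>degree h. (poly ((pderiv ^^ i) h) c / fact i * a ^ i) * x ^ i) \<partial>std_gauss)"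
    by (simp add: poly_taylor[OF order_refl] power_mult_distrib mult.assoc)
  also have "\<dots> = (\<Sum>i\<le>degree h. (poly ((pderiv ^^ i) h) c / fact i * a ^ i) * gauss_moment i)"
    unfolding gauss_moment_def
    by (subst Bochner_Integration.integral_sum)
       (auto intro!: integrable_mult_right std_gauss_power_integrable)
  finally show ?thesis by (simp add: heat_eq_moments poly_sum mult_ac)
qed

text \<open>
  The differences telescope to the rule of index \<open>K\<close>, which is exact for \<open>h\<close>.
\<close>

lemma sum_difference_op:
  assumes "degree h \<le> 2 * K + 1"
  shows "(\<Sum>n\<le>K. difference_op n a h) = heat (a\<^sup>2) h"
proof -
  have "(\<Sum>n\<le>K. difference_op n a h)
     = (\<Sum>i\<le>degree h. smult ((\<Sum>n\<le>K. gh_diff_moment n i) * a ^ i / fact i) ((pderiv ^^ i) h))"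
    unfolding difference_op_def
    by (subst sum.swap) (simp add: smult_sum sum_distrib_right sum_divide_distrib)
  also have "\<dots> = heat (a\<^sup>2) h" unfolding heat_eq_moments
    using assms by (intro sum.cong) (simp_all add: sum_gh_diff_moment)
  finally show ?thesis .
qed

text \<open>
  The semigroup law, by the Cauchy product of the two exponential series. It replaces the
  statement that a sum of independent Gaussian variables is Gaussian.
\<close>

lemma heat_heat: "heat v (heat w h) = heat (v + w) h"
proof -
  define L where "L = degree h"
  define c where "c i j = (v / 2) ^ i / fact i * ((w / 2) ^ j / fact j)" for i j
  define p where "p i = (pderiv ^^ (2 * i)) h" for i
  have p0: "p i = 0" if "i > L" for i using that by (simp add: p_def L_def higher_pderiv_eq_0)
  have "heat v (heat w h) = (\<Sum>i\<le>L. smult ((v / 2) ^ i / fact i) ((pderiv ^^ (2 * i)) (heat w h)))"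
    by (rule heat_upto) (simp add: L_def degree_heat)
  also have "\<dots> = (\<Sum>i\<le>L. \<Sum>j\<le>L. smult (c i j) (p (i + j)))"
    unfolding heat_def[of w h] L_def[symmetric] higher_pderiv_sum higher_pderiv_smult
    by (simp add: c_def p_def smult_sum_right funpow_add distrib_left)
  also have "\<dots> = (\<Sum>(i, j)\<in>{..L} \<times> {..L}. smult (c i j) (p (i + j)))"
    by (rule sum.cartesian_product)
  also have "\<dots> = (\<Sum>(i, j)\<in>{(i, j). i + j \<le> L}. smult (c i j) (p (i + j)))"
    using p0 by (intro sum.mono_neutral_right) (auto, meson not_le)
  also have "\<dots> = (\<Sum>l\<le>L. \<Sum>i\<le>l. smult (c i (l - i)) (p (i + (l - i))))"
    by (rule sum.triangle_reindex_eq)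
  also have "\<dots> = (\<Sum>l\<le>L. smult (\<Sum>i\<le>l. c i (l - i)) (p l))"
    by (simp add: smult_sum)
  finally have step: "heat v (heat w h) = (\<Sum>l\<le>L. smult (\<Sum>i\<le>l. c i (l - i)) (p l))" .
  have "(\<Sum>i\<le>l. c i (l - i)) = ((v + w) / 2) ^ l / fact l" for l
  proof -
    have "((v + w) / 2) ^ l / fact l
        = (\<Sum>i\<le>l. of_nat (l choose i) * (v / 2) ^ i * (w / 2) ^ (l - i) / fact l)"
      unfolding add_divide_distrib binomial_ring sum_divide_distrib ..
    also have "\<dots> = (\<Sum>i\<le>l. c i (l - i))"
      by (intro sum.cong) (auto simp: c_def binomial_fact field_simps)
    finally show ?thesis by simp
  qed
  with step show ?thesis by (simp add: heat_def p_def L_def)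
qed

text \<open>
  The effect on \<open>h\<close> of applying the differences of orders \<open>\<nu> 0, \<dots>, \<nu> (m - 1)\<close> in the first \<open>m\<close> variables
  of \<open>h (c + (\<Sum>j. a j * \<xi> j))\<close>.
\<close>

primrec iterated_difference :: "(nat \<Rightarrow> real) \<Rightarrow> (nat \<Rightarrow> nat) \<Rightarrow> nat \<Rightarrow> real poly \<Rightarrow> real poly" where
  "iterated_difference a \<nu> 0 h = h"
| "iterated_difference a \<nu> (Suc m) h = difference_op (\<nu> m) (a m) (iterated_difference a \<nu> m h)"

lemma degree_iterated_difference: "degree (iterated_difference a \<nu> m h) \<le> degree h"
  by (induction m) (auto intro: order_trans[OF degree_difference_op])

lemma iterated_difference_cong:
  "(\<And>j. j < m \<Longrightarrow> \<nu> j = \<mu> j) \<Longrightarrow> iterated_difference a \<nu> m h = iterated_difference a \<mu> m h"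
  by (induction m) auto

lemma iterated_difference_beyond:
  assumes "m \<le> n" "\<And>j. j \<ge> m \<Longrightarrow> \<nu> j = 0"
  shows "iterated_difference a \<nu> n h = iterated_difference a \<nu> m h"
  using assms(1)
proof (induction n rule: dec_induct)
  case (step n) then show ?case using assms(2)[of n] by (simp add: difference_op_0)
qed simp

text \<open>
  Summing over the box performs the sum over each order separately, and each of these sums is a heat
  operator. The variances add up by the semigroup law.
\<close>

lemma sum_iterated_difference:
  assumes "degree h \<le> 2 * K + 1"
  shows "(\<Sum>\<nu>\<in>index_box m (\<lambda>_. K). iterated_difference a \<nu> m h) = heat (\<Sum>j<m. (a j)\<^sup>2) h"
proof (induction m)
  case (Suc m)
  have lin: "(\<Sum>\<nu>\<in>S. difference_op n (a m) (p \<nu>)) = difference_op n (a m) (\<Sum>\<nu>\<in>S. p \<nu>)"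
    if "finite S" "\<And>\<nu>. degree (p \<nu>) \<le> degree h" for n and S :: "(nat \<Rightarrow> nat) set" and p
  proof -
    have "degree (\<Sum>\<nu>\<in>S. p \<nu>) \<le> degree h" using that by (intro degree_sum_le) auto
    then have "difference_op n (a m) (\<Sum>\<nu>\<in>S. p \<nu>) =
      (\<Sum>i\<le>degree h. smult (gh_diff_moment n i * a m ^ i / fact i) (\<Sum>\<nu>\<in>S. (pderiv ^^ i) (p \<nu>)))"
      by (subst difference_op_upto) (auto simp: higher_pderiv_sum)
    also have "\<dots> = (\<Sum>\<nu>\<in>S. \<Sum>i\<le>degree h. smult (gh_diff_moment n i * a m ^ i / fact i) ((pderiv ^^ i) (p \<nu>)))"
      unfolding smult_sum_right by (rule sum.swap)
    finally show ?thesis using difference_op_upto[OF that(2)] by simp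
  qed
  have upd: "iterated_difference a (\<nu>(m := n)) m h = iterated_difference a \<nu> m h" for \<nu> n
    by (rule iterated_difference_cong) simp
  have "(\<Sum>\<nu>\<in>index_box (Suc m) (\<lambda>_. K). iterated_difference a \<nu> (Suc m) h)
     = (\<Sum>n\<le>K. \<Sum>\<nu>\<in>index_box m (\<lambda>_. K). difference_op n (a m) (iterated_difference a \<nu> m h))"
    unfolding sum_index_box_Suc by (simp add: upd)
  also have "\<dots> = (\<Sum>n\<le>K. difference_op n (a m) (heat (\<Sum>j<m. (a j)\<^sup>2) h))"
    by (simp add: lin finite_index_box degree_iterated_difference Suc.IH)
  also have "\<dots> = heat ((a m)\<^sup>2) (heat (\<Sum>j<m. (a j)\<^sup>2) h)"
    using assms by (intro sum_difference_op) (auto intro: order_trans[OF degree_heat])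
  finally show ?case by (simp add: heat_heat add.commute)
qed (simp add: index_box_0 heat_zero)

text \<open>
  The seminorm in which tensor differences are measured: it dominates the value at \<open>c\<close> and, on
  polynomials of degree at most \<open>k\<close>, differentiation does not increase it.
\<close>

definition jet_norm :: "nat \<Rightarrow> real \<Rightarrow> real poly \<Rightarrow> real" where
  "jet_norm k c h = (\<Sum>i\<le>k. \<bar>poly ((pderiv ^^ i) h) c\<bar>)"

lemma jet_norm_nonneg: "0 \<le> jet_norm k c h"
  by (simp add: jet_norm_def sum_nonneg)

lemma abs_poly_le_jet_norm: "\<bar>poly h c\<bar> \<le> jet_norm k c h"
  unfolding jet_norm_def by (rule order_trans[OF _ member_le_sum[of 0]]) auto

lemma jet_norm_pderiv:
  assumes "degree h \<le> k"
  shows "jet_norm k c ((pderiv ^^ i) h) \<le> jet_norm k c h"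
proof (induction i)
  case (Suc i)
  define g where "g = (pderiv ^^ i) h"
  have "jet_norm k c (pderiv g) = (\<Sum>j\<le>k. \<bar>poly ((pderiv ^^ Suc j) g) c\<bar>)"
    unfolding jet_norm_def by (simp add: funpow_swap1)
  also have "\<dots> \<le> (\<Sum>j\<le>Suc k. \<bar>poly ((pderiv ^^ j) g) c\<bar>)"
    unfolding sum.atMost_Suc_shift[of _ k] by simp
  also have "\<dots> = jet_norm k c g"
    using assms higher_pderiv_eq_0[of g "Suc k"] by (simp add: jet_norm_def g_def degree_higher_pderiv del: funpow.simps)
  finally show ?case using Suc.IH by (simp add: g_def)
qed simp

lemma jet_norm_sum_smult: "jet_norm k c (\<Sum>i\<in>S. smult (u i) (p i)) \<le> (\<Sum>i\<in>S. \<bar>u i\<bar> * jet_norm k c (p i))"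
proof -
  have "jet_norm k c (\<Sum>i\<in>S. smult (u i) (p i))
      = (\<Sum>j\<le>k. \<bar>\<Sum>i\<in>S. u i * poly ((pderiv ^^ j) (p i)) c\<bar>)"
    by (simp add: jet_norm_def higher_pderiv_sum higher_pderiv_smult poly_sum)
  also have "\<dots> \<le> (\<Sum>j\<le>k. \<Sum>i\<in>S. \<bar>u i\<bar> * \<bar>poly ((pderiv ^^ j) (p i)) c\<bar>)"
    by (intro sum_mono order_trans[OF sum_abs]) (simp add: abs_mult)
  also have "\<dots> = (\<Sum>i\<in>S. \<bar>u i\<bar> * jet_norm k c (p i))"
    by (subst sum.swap) (simp add: jet_norm_def sum_distrib_left)
  finally show ?thesis .
qed

text \<open>
  The operator of order \<open>n\<close> contains only derivatives of order at least \<open>2 * n\<close>, each with the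
  corresponding power of \<open>a\<close>; the surplus powers are absorbed in a power of the bound \<open>A\<close>.
\<close>

lemma jet_norm_difference_op:
  assumes "degree h \<le> k" "\<bar>a\<bar> \<le> A" "1 \<le> A"
  shows "jet_norm k c (difference_op n a h)
     \<le> (A ^ k * (\<Sum>i\<le>k. \<bar>gh_diff_moment n i\<bar>)) * (a\<^sup>2) ^ n * jet_norm k c h"
proof -
  have pow: "\<bar>a\<bar> ^ i \<le> A ^ k * (a\<^sup>2) ^ n" if "2 * n \<le> i" "i \<le> k" for i
  proof -
    have "\<bar>a\<bar> ^ i = \<bar>a\<bar> ^ (i - 2 * n) * \<bar>a\<bar> ^ (2 * n)"
      using that by (simp add: power_add[symmetric])
    also have "\<bar>a\<bar> ^ (2 * n) = (a\<^sup>2) ^ n"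
      by (simp add: power_mult)
    finally have "\<bar>a\<bar> ^ i = \<bar>a\<bar> ^ (i - 2 * n) * (a\<^sup>2) ^ n" .
    moreover have "\<bar>a\<bar> ^ (i - 2 * n) \<le> A ^ k"
      using assms that by (meson abs_ge_zero diff_le_self le_trans order_trans power_increasing power_mono)
    ultimately show ?thesis by (simp add: mult_right_mono)
  qed
  have "jet_norm k c (difference_op n a h)
     \<le> (\<Sum>i\<le>k. \<bar>gh_diff_moment n i * a ^ i / fact i\<bar> * jet_norm k c ((pderiv ^^ i) h))"
    unfolding difference_op_upto[OF assms(1)] by (rule jet_norm_sum_smult)
  also have "\<dots> \<le> (\<Sum>i\<le>k. (\<bar>gh_diff_moment n i\<bar> * (A ^ k * (a\<^sup>2) ^ n)) * jet_norm k c h)"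
  proof (intro sum_mono mult_mono jet_norm_pderiv assms jet_norm_nonneg)
    fix i assume "i \<in> {..k}"
    have "\<bar>gh_diff_moment n i * a ^ i / fact i\<bar> \<le> \<bar>gh_diff_moment n i\<bar> * \<bar>a\<bar> ^ i / 1"
      unfolding abs_divide abs_mult power_abs by (intro divide_left_mono) (auto simp: fact_ge_1)
    also have "\<dots> \<le> \<bar>gh_diff_moment n i\<bar> * (A ^ k * (a\<^sup>2) ^ n)"
      using pow[of i] \<open>i \<in> {..k}\<close> gh_diff_moment_eq_0[of i n]
      by (cases "i < 2 * n") (auto intro: mult_left_mono)
    finally show "\<bar>gh_diff_moment n i * a ^ i / fact i\<bar> \<le> \<bar>gh_diff_moment n i\<bar> * (A ^ k * (a\<^sup>2) ^ n)" .
  qed (use assms in auto)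
  also have "\<dots> = (A ^ k * (\<Sum>i\<le>k. \<bar>gh_diff_moment n i\<bar>)) * (a\<^sup>2) ^ n * jet_norm k c h"
    by (simp add: sum_distrib_left sum_distrib_right mult_ac)
  finally show ?thesis .
qed

section \<open>Weights and their smallest indices\<close>

text \<open>
  The factor that a single coordinate contributes to \<open>multi_weight\<close>.
\<close>

definition index_weight :: "nat \<Rightarrow> real \<Rightarrow> nat \<Rightarrow> real" where
  "index_weight r t n = (\<Sum>l\<le>r. real (n choose l) * t ^ (2 * l))"

text \<open>
  Only multi-indices in the box below the support of \<open>\<nu>\<close> contribute, because elsewhere some binomial
  coefficient vanishes. Over the box the sum of products factorises.
\<close>

lemma multi_weight_eq_prod:
  assumes \<nu>: "\<And>j. j \<ge> m \<Longrightarrow> \<nu> j = 0"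
  shows "multi_weight r \<tau> \<nu> = (\<Prod>j<m. index_weight r (\<tau> j) (\<nu> j))"
proof -
  let ?S = "{\<mu>\<in>multi_indices. Max (range \<mu>) \<le> r}"
  let ?F = "\<lambda>\<mu>. (\<Prod>j\<in>{j. \<mu> j \<noteq> 0}. real (\<nu> j choose \<mu> j)) * (\<Prod>j\<in>{j. \<mu> j \<noteq> 0}. \<tau> j ^ (2 * \<mu> j))"
  have fin: "finite (range \<mu>)" if "\<mu> \<in> multi_indices" for \<mu> :: "nat \<Rightarrow> nat"
  proof (rule finite_subset)
    show "range \<mu> \<subseteq> insert 0 (\<mu> ` {j. \<mu> j \<noteq> 0})" by auto
  qed (use that in \<open>simp add: multi_indices_def\<close>)
  have "multi_weight r \<tau> \<nu> = infsum ?F (index_box m (\<lambda>_. r))"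
    unfolding multi_weight_def
  proof (rule infsum_cong_neutral)
    fix \<mu> assume "\<mu> \<in> index_box m (\<lambda>_. r) - ?S"
    then have "\<mu> \<in> multi_indices" "\<not> Max (range \<mu>) \<le> r" "\<And>j. \<mu> j \<le> r"
      using index_box_multi_indices by (auto simp: index_box_def) (metis le_cases not_le zero_le)+
    then show "?F \<mu> = 0" using fin[of \<mu>] by (subst (asm) Max_le_iff) auto
  next
    fix \<mu> assume \<mu>: "\<mu> \<in> ?S - index_box m (\<lambda>_. r)"
    then have mi: "\<mu> \<in> multi_indices" and "\<mu> j \<le> r" for j
      using fin[of \<mu>] Max_ge[of "range \<mu>" "\<mu> j"] by (auto intro: order_trans)
    then obtain j where j: "j \<ge> m" "\<mu> j \<noteq> 0" using \<mu> by (auto simp: index_box_def)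
    then have "real (\<nu> j choose \<mu> j) = 0" using \<nu>[of j] by simp
    then have "(\<Prod>j\<in>{j. \<mu> j \<noteq> 0}. real (\<nu> j choose \<mu> j)) = 0"
      using mi j by (intro prod_zero bexI[of _ j]) (auto simp: multi_indices_def)
    then show "?F \<mu> = 0" by simp
  qed simp
  also have "\<dots> = (\<Sum>\<mu>\<in>index_box m (\<lambda>_. r). ?F \<mu>)"
    by (rule infsum_finite[OF finite_index_box])
  also have "\<dots> = (\<Sum>\<mu>\<in>index_box m (\<lambda>_. r). \<Prod>j<m. real (\<nu> j choose \<mu> j) * \<tau> j ^ (2 * \<mu> j))"
  proof (intro sum.cong refl)
    fix \<mu> assume "\<mu> \<in> index_box m (\<lambda>_. r)"
    then have sub: "{j. \<mu> j \<noteq> 0} \<subseteq> {..<m}" by (auto simp: index_box_def not_less[symmetric])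
    show "?F \<mu> = (\<Prod>j<m. real (\<nu> j choose \<mu> j) * \<tau> j ^ (2 * \<mu> j))"
      unfolding prod.distrib
      by (intro arg_cong2[of _ _ _ _ "(*)"] prod.mono_neutral_left sub) auto
  qed
  also have "\<dots> = (\<Prod>j<m. index_weight r (\<tau> j) (\<nu> j))"
    unfolding index_weight_def by (rule sum_prod_index_box)
  finally show ?thesis .
qed

lemma multi_indices_bound:
  assumes "finite F" "F \<subseteq> multi_indices"
  obtains m K where "F \<subseteq> index_box m (\<lambda>_. K)"
proof -
  have "\<exists>m K. F \<subseteq> index_box m (\<lambda>_. K)" using assms
  proof (induction F)
    case (insert \<nu> F)
    then obtain m K where mK: "F \<subseteq> index_box m (\<lambda>_. K)" by auto
    have fin: "finite {j. \<nu> j \<noteq> 0}" using insert.prems by (auto simp: multi_indices_def)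
    define M where "M = Max (insert 0 (Suc ` {j. \<nu> j \<noteq> 0}))"
    define L where "L = Max (insert 0 (\<nu> ` {j. \<nu> j \<noteq> 0}))"
    have M: "j < M" if "\<nu> j \<noteq> 0" for j
    proof -
      have "Suc j \<le> M" unfolding M_def using fin that by (intro Max_ge) auto
      then show ?thesis by simp
    qed
    have L: "\<nu> j \<le> L" for j
    proof (cases "\<nu> j = 0")
      case False then show ?thesis unfolding L_def using fin by (intro Max_ge) auto
    qed simp
    have "\<nu> \<in> index_box (max m M) (\<lambda>_. max K L)"
      using M L by (auto simp: index_box_def le_max_iff_disj) (metis not_less not_gr_zero)
    moreover have "index_box m (\<lambda>_. K) \<subseteq> index_box (max m M) (\<lambda>_. max K L)"
    proof
      fix \<mu> assume \<mu>: "\<mu> \<in> index_box m (\<lambda>_. K)"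
      then have "\<mu> j \<le> K" for j by (cases "j < m") (auto simp: index_box_def)
      then show "\<mu> \<in> index_box (max m M) (\<lambda>_. max K L)"
        using \<mu> by (auto simp: index_box_def le_max_iff_disj)
    qed
    ultimately have "insert \<nu> F \<subseteq> index_box (max m M) (\<lambda>_. max K L)" using mK by blast
    then show ?case by blast
  qed simp
  then show ?thesis using that by blast
qed

lemma multi_index_support:
  assumes "\<nu> \<in> multi_indices"
  obtains m where "\<And>j. j \<ge> m \<Longrightarrow> \<nu> j = 0"
proof -
  obtain m K where "{\<nu>} \<subseteq> index_box m (\<lambda>_. K)" using multi_indices_bound[of "{\<nu>}"] assms by auto
  then show ?thesis by (intro that[of m]) (auto simp: index_box_def)
qed

lemma index_weight_ge_1: "1 \<le> index_weight r t n"
proof -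
  have "1 \<le> real (n choose 0) * t ^ (2 * 0)" by simp
  also have "\<dots> \<le> index_weight r t n"
    unfolding index_weight_def by (rule member_le_sum) auto
  finally show ?thesis .
qed

text \<open>
  The linear term of the binomial sum is strictly increasing in \<open>n\<close>. Strictness excludes ties between
  comparable multi-indices, so that every set of smallest indices is downward closed.
\<close>

lemma index_weight_strict_mono:
  assumes "1 \<le> r" "t \<noteq> 0"
  shows "strict_mono (index_weight r t)"
proof (rule strict_mono_Suc_iff[THEN iffD2], intro allI)
  fix n
  have "real (n choose 1) * t ^ (2 * 1) < real (Suc n choose 1) * t ^ (2 * 1)"
    using assms by (intro mult_strict_right_mono) auto
  then have "\<exists>l\<in>{..r}. real (n choose l) * t ^ (2 * l) < real (Suc n choose l) * t ^ (2 * l)"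
    using assms by (intro bexI[of _ 1]) auto
  moreover have "real (n choose l) * t ^ (2 * l) \<le> real (Suc n choose l) * t ^ (2 * l)" for l
    by (intro mult_right_mono) (auto simp: binomial_right_mono)
  ultimately show "index_weight r t n < index_weight r t (Suc n)"
    unfolding index_weight_def by (intro sum_strict_mono_ex1) auto
qed

text \<open>
  The factor is the binomial expansion of the right-hand side, cut off at \<open>r\<close>.
\<close>

lemma index_weight_le: "index_weight r t n \<le> (1 + t\<^sup>2) ^ n"
proof -
  have "index_weight r t n \<le> (\<Sum>l\<le>r + n. real (n choose l) * t ^ (2 * l))"
    unfolding index_weight_def by (intro sum_mono2) auto
  also have "\<dots> = (\<Sum>l\<le>n. real (n choose l) * t ^ (2 * l))"
    by (intro sum.mono_neutral_right) auto
  also have "\<dots> = (t\<^sup>2 + 1) ^ n"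
    unfolding binomial_ring by (simp add: power_mult)
  finally show ?thesis by (simp add: add.commute)
qed

text \<open>
  For \<open>n \<ge> r\<close> the top term of the sum has the required size, for \<open>n < r\<close> the linear one. The bound
  grows like \<open>n ^ r\<close>, which makes negative powers of the factor summable over \<open>n\<close>.
\<close>

lemma index_weight_ge:
  assumes "1 \<le> r" "1 \<le> t" "1 \<le> n"
  shows "t\<^sup>2 * (real n / real r) ^ r \<le> index_weight r t n"
proof -
  have mem: "real (n choose l) * t ^ (2 * l) \<le> index_weight r t n" if "l \<le> r" for l
    unfolding index_weight_def by (rule member_le_sum) (use that in auto)
  show ?thesis
  proof (cases "r \<le> n")
    case True
    have "t\<^sup>2 * (real n / real r) ^ r \<le> t ^ (2 * r) * real (n choose r)"
      using assms True by (intro mult_mono power_increasing binomial_ge_n_over_k_pow_k) auto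
    also have "\<dots> \<le> index_weight r t n" using mem[of r] by (simp add: mult.commute)
    finally show ?thesis .
  next
    case False
    then have "(real n / real r) ^ r \<le> 1" using assms by (intro power_le_one) auto
    then have "t\<^sup>2 * (real n / real r) ^ r \<le> t\<^sup>2 * real n" using assms
      by (intro mult_left_mono) auto
    also have "\<dots> \<le> index_weight r t n" using mem[of 1] assms by (simp add: mult.commute)
    finally show ?thesis .
  qed
qed

lemma multi_weight_ge_1: 
  assumes "\<nu> \<in> multi_indices" shows "1 \<le> multi_weight r \<tau> \<nu>"
proof -
  obtain m where m: "\<And>j. j \<ge> m \<Longrightarrow> \<nu> j = 0" using multi_index_support[OF assms] by metis
  have "multi_weight r \<tau> \<nu> = (\<Prod>j<m. index_weight r (\<tau> j) (\<nu> j))"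
    using m by (rule multi_weight_eq_prod)
  then show ?thesis by (simp add: prod_ge_1 index_weight_ge_1)
qed

lemma multi_weight_strict_mono:
  assumes r: "1 \<le> r" and \<tau>: "\<And>j. \<tau> j \<noteq> 0"
    and "\<nu> \<in> multi_indices" and le: "\<And>j. \<mu> j \<le> \<nu> j" and "\<mu> \<noteq> \<nu>"
  shows "multi_weight r \<tau> \<mu> < multi_weight r \<tau> \<nu>"
proof -
  obtain m where m: "\<And>j. j \<ge> m \<Longrightarrow> \<nu> j = 0" using multi_index_support[OF assms(3)] by metis
  then have m': "\<And>j. j \<ge> m \<Longrightarrow> \<mu> j = 0" using le by (metis le_zero_eq)
  let ?w = "\<lambda>\<nu> j. index_weight r (\<tau> j) (\<nu> j)"
  have mono: "?w \<mu> j \<le> ?w \<nu> j" and pos: "0 < ?w \<nu> j" "0 < ?w \<mu> j" for j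
    using index_weight_strict_mono[OF r \<tau>] le index_weight_ge_1[of r "\<tau> j"]
    by (auto simp: strict_mono_less_eq intro: less_le_trans[OF zero_less_one])
  obtain i where i: "\<mu> i \<noteq> \<nu> i" using \<open>\<mu> \<noteq> \<nu>\<close> by auto
  then have "i < m" using m m' by (metis not_less)
  have "\<mu> i < \<nu> i" using le[of i] i by simp
  then have "?w \<mu> i < ?w \<nu> i" using index_weight_strict_mono[OF r \<tau>] by (simp add: strict_mono_less)
  then have "?w \<mu> i * (\<Prod>j\<in>{..<m} - {i}. ?w \<mu> j) < ?w \<nu> i * (\<Prod>j\<in>{..<m} - {i}. ?w \<nu> j)"
    using pos mono by (intro mult_less_le_imp_less prod_mono prod_pos) (auto intro: less_imp_le)
  then show ?thesis
    using \<open>i < m\<close> by (simp add: multi_weight_eq_prod[OF m] multi_weight_eq_prod[OF m'] prod.remove[of "{..<m}" i])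
qed

lemma sum_index_weight_powr_le:
  assumes "1 \<le> r" "1 \<le> t" "p > 0"
  shows "(\<Sum>n\<le>K. index_weight r t n powr - p)
     \<le> 1 + (real r powr (real r * p) * (\<Sum>n=1..K. real n powr - (real r * p))) * (t\<^sup>2) powr - p"
proof -
  have "(\<Sum>n\<le>K. index_weight r t n powr - p)
     = index_weight r t 0 powr - p + (\<Sum>n=1..K. index_weight r t n powr - p)"
    by (simp add: sum.atMost_shift sum.atLeast1_atMost_eq lessThan_Suc_atMost)
  also have "index_weight r t 0 powr - p \<le> 1"
    using index_weight_ge_1[of r t 0] assms powr_mono2'[of "-p" 1 "index_weight r t 0"] by simp
  also have "(\<Sum>n=1..K. index_weight r t n powr - p)
     \<le> (\<Sum>n=1..K. real r powr (real r * p) * real n powr - (real r * p) * (t\<^sup>2) powr - p)"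
  proof (intro sum_mono)
    fix n assume n: "n \<in> {1..K}"
    have "index_weight r t n powr - p \<le> (t\<^sup>2 * (real n / real r) ^ r) powr - p"
      using assms n by (intro powr_mono2' index_weight_ge) auto
    also have "\<dots> = (t\<^sup>2) powr - p * ((real n / real r) powr real r) powr - p"
      using assms n by (simp add: powr_mult powr_realpow)
    also have "((real n / real r) powr real r) powr - p = real r powr (real r * p) * real n powr - (real r * p)"
      using assms n by (simp add: powr_powr powr_divide powr_minus_divide field_simps)
    finally show "index_weight r t n powr - p \<le> real r powr (real r * p) * real n powr - (real r * p) * (t\<^sup>2) powr - p"
      by (simp add: mult_ac)
  qed
  finally show ?thesis by (simp add: sum_distrib_left sum_distrib_right)
qed

lemma prod_one_plus_le_exp:
  fixes w :: "nat \<Rightarrow> real"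
  assumes "\<And>j. 0 \<le> w j" "summable w"
  shows "(\<Prod>j<m. 1 + w j) \<le> exp (\<Sum>j. w j)"
proof -
  have "(\<Prod>j<m. 1 + w j) \<le> (\<Prod>j<m. exp (w j))"
    using assms by (intro prod_mono) (auto simp: exp_ge_add_one_self)
  also have "\<dots> = exp (\<Sum>j<m. w j)" by (simp add: exp_sum)
  also have "\<dots> \<le> exp (\<Sum>j. w j)" using assms by (simp add: sum_le_suminf)
  finally show ?thesis .
qed

text \<open>
  Over a box the sum is a product of one-dimensional sums \<open>1 + O((\<tau> j)\<^sup>2 powr - p)\<close>, and such products are
  bounded by the exponential of the sum of the perturbations.
\<close>

lemma multi_weight_powr_sum_bounded:
  assumes r: "1 \<le> r" and \<tau>: "\<And>j. 1 \<le> \<tau> j" and p: "0 < p" "1 < real r * p"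
    and summ: "summable (\<lambda>j. ((\<tau> j)\<^sup>2) powr - p)"
  obtains M where "0 < M"
    "\<And>F. finite F \<Longrightarrow> F \<subseteq> multi_indices \<Longrightarrow> (\<Sum>\<nu>\<in>F. multi_weight r \<tau> \<nu> powr - p) \<le> M"
proof -
  define C where "C = real r powr (real r * p) * (\<Sum>n. real n powr - (real r * p))"
  have sn: "summable (\<lambda>n. real n powr - (real r * p))" using p by (simp add: summable_real_powr_iff)
  have C: "0 \<le> C" unfolding C_def by (intro mult_nonneg_nonneg suminf_nonneg sn) auto
  have iw: "(\<Sum>n\<le>K. index_weight r (\<tau> j) n powr - p) \<le> 1 + C * ((\<tau> j)\<^sup>2) powr - p" for j K
  proof (rule order_trans[OF sum_index_weight_powr_le])
    have "(\<Sum>n=1..K. real n powr - (real r * p)) \<le> (\<Sum>n. real n powr - (real r * p))"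
      by (intro sum_le_suminf sn) auto
    then show "1 + real r powr (real r * p) * (\<Sum>n=1..K. real n powr - (real r * p)) * (\<tau> j)\<^sup>2 powr - p
      \<le> 1 + C * (\<tau> j)\<^sup>2 powr - p"
      unfolding C_def by (intro add_left_mono mult_right_mono mult_left_mono) auto
  qed (use assms in auto)
  define M where "M = exp (\<Sum>j. C * ((\<tau> j)\<^sup>2) powr - p)"
  show thesis
  proof (rule that[of M])
    show "0 < M" by (simp add: M_def)
    fix F :: "(nat \<Rightarrow> nat) set" assume F: "finite F" "F \<subseteq> multi_indices"
    then obtain m K where mK: "F \<subseteq> index_box m (\<lambda>_. K)" using multi_indices_bound by blast
    have "(\<Sum>\<nu>\<in>F. multi_weight r \<tau> \<nu> powr - p) \<le> (\<Sum>\<nu>\<in>index_box m (\<lambda>_. K). multi_weight r \<tau> \<nu> powr - p)"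
      using mK by (intro sum_mono2 finite_index_box) auto
    also have "\<dots> = (\<Sum>\<nu>\<in>index_box m (\<lambda>_. K). \<Prod>j<m. index_weight r (\<tau> j) (\<nu> j) powr - p)"
    proof (intro sum.cong refl)
      fix \<nu> assume "\<nu> \<in> index_box m (\<lambda>_. K)"
      then have "multi_weight r \<tau> \<nu> = (\<Prod>j<m. index_weight r (\<tau> j) (\<nu> j))"
        by (intro multi_weight_eq_prod) (auto simp: index_box_def)
      then show "multi_weight r \<tau> \<nu> powr - p = (\<Prod>j<m. index_weight r (\<tau> j) (\<nu> j) powr - p)"
        by (simp add: prod_powr_distrib order_trans[OF zero_le_one index_weight_ge_1])
    qed
    also have "\<dots> = (\<Prod>j<m. \<Sum>n\<le>K. index_weight r (\<tau> j) n powr - p)"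
      by (rule sum_prod_index_box)
    also have "\<dots> \<le> (\<Prod>j<m. 1 + C * ((\<tau> j)\<^sup>2) powr - p)"
      by (intro prod_mono) (auto intro: iw sum_nonneg)
    also have "\<dots> \<le> M" unfolding M_def
      using C by (intro prod_one_plus_le_exp summable_mult summ) auto
    finally show "(\<Sum>\<nu>\<in>F. multi_weight r \<tau> \<nu> powr - p) \<le> M" .
  qed
qed

lemma infinite_multi_indices: "infinite multi_indices"
proof
  assume "finite multi_indices"
  moreover have "range (\<lambda>n. (\<lambda>_. 0)(0 := n)) \<subseteq> multi_indices"
  proof clarify
    fix n :: nat
    have "{j. ((\<lambda>_. 0)(0 := n)) j \<noteq> 0} \<subseteq> {0 :: nat}" by auto
    then show "(\<lambda>_. 0)(0 := n) \<in> multi_indices" unfolding multi_indices_def using finite_subset by blast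
  qed
  moreover have "inj (\<lambda>n::nat. (\<lambda>_::nat. 0::nat)(0 := n))"
    by (rule injI) (metis fun_upd_same)
  ultimately show False using finite_subset finite_imageD infinite_UNIV_nat by blast
qed

text \<open>
  If all sublevel sets are finite, minimal elements of the complement exist and can be added one at a
  time.
\<close>

lemma smallest_indices_exist:
  assumes fin: "\<And>B. finite {\<nu>\<in>multi_indices. b \<nu> \<le> (B::real)}"
  shows "\<exists>\<Lambda>. smallest_indices b N \<Lambda>"
proof (induction N)
  case 0
  have "smallest_indices b 0 {}" by (simp add: smallest_indices_def)
  then show ?case by blast
next
  case (Suc N)
  then obtain \<Lambda> where \<Lambda>: "smallest_indices b N \<Lambda>" by blast
  then have "multi_indices - \<Lambda> \<noteq> {}" using infinite_multi_indices
    by (metis Diff_eq_empty_iff finite_subset smallest_indices_def)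
  then obtain \<nu>0 where \<nu>0: "\<nu>0 \<in> multi_indices - \<Lambda>" by blast
  define S where "S = {\<nu>\<in>multi_indices. b \<nu> \<le> b \<nu>0} - \<Lambda>"
  have S: "finite S" "S \<noteq> {}" using fin \<nu>0 by (auto simp: S_def)
  obtain \<nu> where \<nu>: "\<nu> \<in> S" "\<And>\<mu>. \<mu> \<in> S \<Longrightarrow> b \<nu> \<le> b \<mu>"
    using finite_has_minimal S arg_min_if_finite[OF S, of b] by (metis not_le)
  have "b \<nu> \<le> b \<mu>" if "\<mu> \<in> multi_indices - \<Lambda>" for \<mu>
    using \<nu> that by (cases "b \<mu> \<le> b \<nu>0") (force simp: S_def)+
  then have "smallest_indices b (Suc N) (insert \<nu> \<Lambda>)"
    using \<Lambda> \<nu>(1) unfolding smallest_indices_def S_def by auto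
  then show ?case by blast
qed

lemma admissible_smallest_indices:
  assumes "1 \<le> r" "\<And>j. \<tau> j \<noteq> 0" "smallest_indices (multi_weight r \<tau>) N \<Lambda>"
  shows "admissible \<Lambda>"
  unfolding admissible_def
proof (intro conjI ballI impI)
  show "\<Lambda> \<subseteq> multi_indices" using assms(3) by (simp add: smallest_indices_def)
  fix \<nu> \<mu> assume *: "\<nu> \<in> \<Lambda>" "\<mu> \<in> multi_indices" "\<forall>j. \<mu> j \<le> \<nu> j"
  show "\<mu> \<in> \<Lambda>"
  proof (rule ccontr)
    assume "\<mu> \<notin> \<Lambda>"
    then have "multi_weight r \<tau> \<nu> \<le> multi_weight r \<tau> \<mu>" "\<mu> \<noteq> \<nu>"
      using assms(3) * by (auto simp: smallest_indices_def)
    moreover have "multi_weight r \<tau> \<mu> < multi_weight r \<tau> \<nu>"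
      using * \<open>\<mu> \<noteq> \<nu>\<close> \<open>\<Lambda> \<subseteq> multi_indices\<close> by (intro multi_weight_strict_mono assms) auto
    ultimately show False by simp
  qed
qed

text \<open>
  A Chebyshev-type count: if \<open>\<nu>\<close> lies outside the \<open>N\<close> smallest indices, then \<open>N\<close> terms of the sum of
  \<open>b powr - p\<close> are at least \<open>b \<nu> powr - p\<close>, and the sum is at most \<open>M\<close>.
\<close>

lemma smallest_indices_multi_weight:
  assumes r: "1 \<le> r" and \<tau>: "\<And>j. 1 \<le> \<tau> j" and p: "0 < p" "1 < real r * p"
    and summ: "summable (\<lambda>j. ((\<tau> j)\<^sup>2) powr - p)"
  obtains M where "0 < M"
    "\<And>N. \<exists>\<Lambda>. admissible \<Lambda> \<and> smallest_indices (multi_weight r \<tau>) N \<Lambda> \<and>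
       (\<forall>\<nu>\<in>multi_indices - \<Lambda>. (real N / M) powr (1 / p) \<le> multi_weight r \<tau> \<nu>)"
proof -
  let ?b = "multi_weight r \<tau>"
  obtain M where M: "0 < M"
    "\<And>F. finite F \<Longrightarrow> F \<subseteq> multi_indices \<Longrightarrow> (\<Sum>\<nu>\<in>F. ?b \<nu> powr - p) \<le> M"
    using multi_weight_powr_sum_bounded[OF assms] by blast
  have card: "real (card F) * B powr - p \<le> M"
    if "finite F" "F \<subseteq> multi_indices" "\<And>\<nu>. \<nu> \<in> F \<Longrightarrow> ?b \<nu> \<le> B" for F B
  proof -
    have "real (card F) * B powr - p = (\<Sum>\<nu>\<in>F. B powr - p)" by simp
    also have "\<dots> \<le> (\<Sum>\<nu>\<in>F. ?b \<nu> powr - p)"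
      using that p multi_weight_ge_1[of _ r \<tau>]
      by (intro sum_mono powr_mono2') (auto intro: less_le_trans[OF zero_less_one])
    finally show ?thesis using M(2)[OF that(1,2)] by simp
  qed
  have fin: "finite {\<nu>\<in>multi_indices. ?b \<nu> \<le> B}" for B
  proof (cases "0 < B")
    case True
    have "finite {\<nu>\<in>multi_indices. ?b \<nu> \<le> B} \<and> card {\<nu>\<in>multi_indices. ?b \<nu> \<le> B} \<le> nat \<lceil>M * B powr p\<rceil>"
    proof (rule finite_if_finite_subsets_card_bdd)
      fix F assume "F \<subseteq> {\<nu>\<in>multi_indices. ?b \<nu> \<le> B}" "finite F"
      then have "real (card F) * B powr - p \<le> M" by (intro card) auto
      then have "real (card F) \<le> M * B powr p" using True by (simp add: powr_minus field_simps)
      then show "card F \<le> nat \<lceil>M * B powr p\<rceil>" by linarith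
    qed
    then show ?thesis ..
  next
    case False
    then have "{\<nu>\<in>multi_indices. ?b \<nu> \<le> B} = {}" using multi_weight_ge_1[of _ r \<tau>] by force
    then show ?thesis by (simp only: finite.emptyI)
  qed
  show thesis
  proof (rule that[OF M(1)])
    fix N
    obtain \<Lambda> where \<Lambda>: "smallest_indices ?b N \<Lambda>" using smallest_indices_exist[OF fin] by blast
    have "\<tau> j \<noteq> 0" for j using \<tau>[of j] by auto
    then have "admissible \<Lambda>" using r \<Lambda> by (intro admissible_smallest_indices)
    moreover have "(real N / M) powr (1 / p) \<le> ?b \<nu>" if \<nu>: "\<nu> \<in> multi_indices - \<Lambda>" for \<nu>
    proof -
      have b: "0 < ?b \<nu>" using multi_weight_ge_1[of \<nu> r \<tau>] \<nu> by simp
      have "real N * ?b \<nu> powr - p \<le> M"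
        using card[of \<Lambda> "?b \<nu>"] \<Lambda> \<nu> by (auto simp: smallest_indices_def)
      then have "real N / M \<le> ?b \<nu> powr p" using M(1) b by (simp add: powr_minus field_simps)
      then have "(real N / M) powr (1 / p) \<le> (?b \<nu> powr p) powr (1 / p)"
        using M p by (intro powr_mono2) auto
      then show ?thesis using b p by (simp add: powr_powr)
    qed
    ultimately show "\<exists>\<Lambda>. admissible \<Lambda> \<and> smallest_indices ?b N \<Lambda> \<and>
       (\<forall>\<nu>\<in>multi_indices - \<Lambda>. (real N / M) powr (1 / p) \<le> ?b \<nu>)" using \<Lambda> by blast
  qed
qed

lemma multi_weight_le_prod:
  assumes "\<And>j. j \<ge> m \<Longrightarrow> \<nu> j = 0"
  shows "multi_weight r \<tau> \<nu> \<le> (\<Prod>j<m. (1 + (\<tau> j)\<^sup>2) ^ \<nu> j)"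
proof -
  have "multi_weight r \<tau> \<nu> = (\<Prod>j<m. index_weight r (\<tau> j) (\<nu> j))"
    using assms by (rule multi_weight_eq_prod)
  also have "\<dots> \<le> (\<Prod>j<m. (1 + (\<tau> j)\<^sup>2) ^ \<nu> j)"
    by (intro prod_mono conjI index_weight_le order_trans[OF zero_le_one index_weight_ge_1])
  finally show ?thesis .
qed

lemma weight_order_props:
  assumes "0 < q" "q < 1"
  shows "1 \<le> weight_order q" "1 < real (weight_order q) * (q / 2)"
proof -
  obtain n where "real n > 14 / q" using reals_Archimedean2 by blast
  then have w: "real (weight_order q) > 14 / q" unfolding weight_order_def by (rule LeastI)
  then show "1 < real (weight_order q) * (q / 2)" using assms by (simp add: field_simps)
  have "0 < 14 / q" using assms by simp
  then show "1 \<le> weight_order q" using w by (cases "weight_order q") auto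
qed

lemma smallest_indices_power_weights:
  assumes q: "0 < q" "q < 1" and \<beta>: "1 < \<beta> * q"
  defines "\<tau> \<equiv> \<lambda>j. real (Suc j) powr \<beta>"
  obtains M where "summable (\<lambda>j. (1 / \<tau> j) powr q)" "0 < M"
    "\<And>N. \<exists>\<Lambda>. admissible \<Lambda> \<and> smallest_indices (multi_weight (weight_order q) \<tau>) N \<Lambda> \<and>
       (\<forall>\<nu>\<in>multi_indices - \<Lambda>. (real N / M) powr (2 / q) \<le> multi_weight (weight_order q) \<tau> \<nu>)"
proof -
  have \<beta>0: "0 < \<beta>" using \<beta> q(1) by (smt (verit) mult_nonpos_nonneg)
  have \<tau>: "1 \<le> \<tau> j" for j unfolding \<tau>_def using \<beta>0 by (intro ge_one_powr_ge_zero) auto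
  have eq: "(1 / \<tau> j) powr q = real (Suc j) powr - (\<beta> * q)" for j
    unfolding \<tau>_def by (simp add: powr_divide powr_powr powr_minus_divide)
  have "summable (\<lambda>n. real n powr - (\<beta> * q))" using \<beta> by (simp add: summable_real_powr_iff)
  then have sm: "summable (\<lambda>j. (1 / \<tau> j) powr q)" unfolding eq by (subst summable_Suc_iff)
  have "((\<tau> j)\<^sup>2) powr - (q / 2) = (1 / \<tau> j) powr q" for j
  proof -
    have "(\<tau> j)\<^sup>2 = \<tau> j powr 2" using \<tau>[of j] by (simp add: powr_numeral)
    then have "((\<tau> j)\<^sup>2) powr - (q / 2) = \<tau> j powr - q" by (simp only: powr_powr) simp
    then show ?thesis using \<tau>[of j] by (simp add: powr_minus_divide powr_divide)
  qed
  then have sm2: "summable (\<lambda>j. ((\<tau> j)\<^sup>2) powr - (q / 2))" using sm by simp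
  have "0 < q / 2" using q by simp
  from smallest_indices_multi_weight[of "weight_order q" \<tau> "q / 2",
      OF weight_order_props(1)[OF q] \<tau> this weight_order_props(2)[OF q] sm2]
  obtain M where "0 < M"
    "\<And>N. \<exists>\<Lambda>. admissible \<Lambda> \<and> smallest_indices (multi_weight (weight_order q) \<tau>) N \<Lambda> \<and>
       (\<forall>\<nu>\<in>multi_indices - \<Lambda>. (real N / M) powr (1 / (q / 2)) \<le> multi_weight (weight_order q) \<tau> \<nu>)"
    by metis
  then show ?thesis using that[OF sm, of M] by simp
qed

section \<open>The law of a Gaussian series\<close>

lemma prob_space_gauss_product: "prob_space gauss_product"
  unfolding gauss_product_def by (intro prob_space_PiM prob_space_std_gauss)

interpretation gauss_product: prob_space gauss_product
  by (rule prob_space_gauss_product)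

lemma gauss_product_coordinate_measurable [measurable]: "(\<lambda>\<xi>. \<xi> j) \<in> borel_measurable gauss_product"
proof -
  have "(\<lambda>\<xi>. \<xi> j) \<in> measurable gauss_product std_gauss"
    unfolding gauss_product_def by (rule measurable_component_singleton) simp
  then show ?thesis by (simp cong: measurable_cong_sets)
qed

lemma distr_gauss_product_coordinate: "distr gauss_product borel (\<lambda>\<xi>. \<xi> j) = std_gauss"
proof -
  have "distr gauss_product borel (\<lambda>\<xi>. \<xi> j) = distr gauss_product std_gauss (\<lambda>\<xi>. \<xi> j)"
    by (rule distr_cong) auto
  also have "\<dots> = std_gauss"
    unfolding gauss_product_def by (rule distr_PiM_component) (simp_all add: prob_space_std_gauss)
  finally show ?thesis .
qed

lemma gauss_product_indep: "gauss_product.indep_vars (\<lambda>_. borel) (\<lambda>j \<xi>. \<xi> j) UNIV"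
proof (subst gauss_product.indep_vars_iff_distr_eq_PiM)
  have "distr gauss_product (\<Pi>\<^sub>M i\<in>UNIV. borel) (\<lambda>\<xi>. \<lambda>i\<in>UNIV. \<xi> i)
      = distr gauss_product gauss_product (\<lambda>\<xi>. \<xi>)"
    by (rule distr_cong) (auto simp: gauss_product_def intro!: sets_PiM_cong)
  then show "distr gauss_product (\<Pi>\<^sub>M i\<in>UNIV. borel) (\<lambda>\<xi>. \<lambda>i\<in>UNIV. \<xi> i)
     = (\<Pi>\<^sub>M i\<in>UNIV. distr gauss_product borel (\<lambda>\<xi>. \<xi> i))"
    unfolding distr_gauss_product_coordinate by (simp add: gauss_product_def)
qed auto

text \<open>
  The expectation of the series is the sum of the weights, hence finite.
\<close>

lemma AE_summable_weighted_squares: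
  assumes "\<And>j. 0 \<le> w j" "summable w"
  shows "AE \<xi> in gauss_product. summable (\<lambda>j. w j * (\<xi> j)\<^sup>2)"
proof -
  have 1: "(\<integral>\<^sup>+\<xi>. ennreal (w j * (\<xi> j)\<^sup>2) \<partial>gauss_product) = ennreal (w j)" for j
  proof -
    have "(\<integral>\<^sup>+\<xi>. ennreal (w j * (\<xi> j)\<^sup>2) \<partial>gauss_product)
        = (\<integral>\<^sup>+x. ennreal (w j * x\<^sup>2) \<partial>distr gauss_product borel (\<lambda>\<xi>. \<xi> j))"
      by (subst nn_integral_distr) auto
    also have "\<dots> = ennreal (\<integral>x. w j * x\<^sup>2 \<partial>std_gauss)"
      unfolding distr_gauss_product_coordinate using assms
      by (intro nn_integral_eq_integral) (auto intro: std_gauss_power_integrable)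
    also have "(\<integral>x. w j * x\<^sup>2 \<partial>std_gauss) = w j"
      using gauss_moment_even[of 1] by (simp add: gauss_moment_def)
    finally show ?thesis .
  qed
  have "(\<integral>\<^sup>+\<xi>. (\<Sum>j. ennreal (w j * (\<xi> j)\<^sup>2)) \<partial>gauss_product) = (\<Sum>j. ennreal (w j))"
    by (subst nn_integral_suminf) (auto simp: 1)
  also have "\<dots> = ennreal (\<Sum>j. w j)" using assms by (rule suminf_ennreal2)
  finally have "AE \<xi> in gauss_product. (\<Sum>j. ennreal (w j * (\<xi> j)\<^sup>2)) \<noteq> \<infinity>"
    by (intro nn_integral_PInf_AE) auto
  then show ?thesis
  proof eventually_elim
    case (elim \<xi>)
    then show ?case using assms by (intro summable_suminf_not_top) auto
  qed
qed

lemma scale_measurable_std_gauss [measurable]: "(*) b \<in> borel_measurable std_gauss"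
proof -
  have "(*) b \<in> borel_measurable borel" by measurable
  then show ?thesis by (simp cong: measurable_cong_sets)
qed

lemma char_scaled_std_gauss: "char (distr std_gauss borel (\<lambda>x. b * x)) t = exp (- (t\<^sup>2 * b\<^sup>2) / 2)"
proof -
  have "char (distr std_gauss borel (\<lambda>x. b * x)) t = char std_gauss (t * b)"
    unfolding char_def by (subst integral_distr) (auto simp: mult.assoc)
  also have "\<dots> = complex_of_real (exp (- (t * b)\<^sup>2 / 2))"
    using char_std_normal_distribution unfolding std_gauss_def by (metis (no_types, lifting))
  finally show ?thesis by (simp add: power_mult_distrib)
qed

text \<open>
  The partial sums have explicit characteristic functions, which pass to the limit by dominated
  convergence. The limit is that of a Gaussian variable, and characteristic functions determine the
  law. Identifying the law gives the mean of every polynomial in the series at once.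
\<close>

lemma distr_gauss_series:
  assumes a: "summable (\<lambda>j. (a j)\<^sup>2)"
    and conv: "AE \<xi> in gauss_product. summable (\<lambda>j. a j * \<xi> j)"
  shows "distr gauss_product borel (\<lambda>\<xi>. \<Sum>j. a j * \<xi> j)
    = distr std_gauss borel (\<lambda>x. sqrt (\<Sum>j. (a j)\<^sup>2) * x)"
proof (rule Levy_uniqueness)
  interpret std_gauss: prob_space std_gauss by (rule prob_space_std_gauss)
  show "real_distribution (distr gauss_product borel (\<lambda>\<xi>. \<Sum>j. a j * \<xi> j))"
    by (rule gauss_product.real_distribution_distr) measurable
  show "real_distribution (distr std_gauss borel (\<lambda>x. sqrt (\<Sum>j. (a j)\<^sup>2) * x))"
    by (rule std_gauss.real_distribution_distr) measurable
  define S where "S m \<xi> = (\<Sum>j<m. a j * \<xi> j)" for m :: nat and \<xi>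
  have [measurable]: "S m \<in> borel_measurable gauss_product" for m unfolding S_def by measurable
  have charS: "(CLINT \<xi>|gauss_product. iexp (t * S m \<xi>)) = exp (- (t\<^sup>2 * (\<Sum>j<m. (a j)\<^sup>2)) / 2)" for m t
  proof -
    have "gauss_product.indep_vars (\<lambda>_. borel) (\<lambda>j \<xi>. a j * \<xi> j) {..<m}"
      by (rule gauss_product.indep_vars_compose2[where X="\<lambda>j \<xi>. \<xi> j" and M'="\<lambda>_. borel"])
         (auto intro: gauss_product.indep_vars_subset[OF gauss_product_indep])
    then have "char (distr gauss_product borel (S m)) t
       = (\<Prod>j<m. char (distr gauss_product borel (\<lambda>\<xi>. a j * \<xi> j)) t)"
      unfolding S_def by (rule gauss_product.char_distr_sum)
    also have "\<dots> = (\<Prod>j<m. exp (- (t\<^sup>2 * (a j)\<^sup>2) / 2))"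
    proof -
      have "distr gauss_product borel (\<lambda>\<xi>. a j * \<xi> j) = distr std_gauss borel (\<lambda>x. a j * x)" for j
        using distr_distr[of "\<lambda>x. a j * x" borel borel "\<lambda>\<xi>. \<xi> j" gauss_product]
        by (simp add: distr_gauss_product_coordinate o_def)
      then show ?thesis by (simp add: char_scaled_std_gauss)
    qed
    also have "\<dots> = exp (- (t\<^sup>2 * (\<Sum>j<m. (a j)\<^sup>2)) / 2)"
      by (simp add: exp_sum[symmetric] sum_distrib_left sum_divide_distrib sum_negf)
    finally show ?thesis unfolding char_def by (subst (asm) integral_distr) auto
  qed
  show "char (distr gauss_product borel (\<lambda>\<xi>. \<Sum>j. a j * \<xi> j))
      = char (distr std_gauss borel (\<lambda>x. sqrt (\<Sum>j. (a j)\<^sup>2) * x))"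
  proof
    fix t
    have "(\<lambda>m. CLINT \<xi>|gauss_product. iexp (t * S m \<xi>)) \<longlonglongrightarrow>
       (CLINT \<xi>|gauss_product. iexp (t * (\<Sum>j. a j * \<xi> j)))"
    proof (rule integral_dominated_convergence[where w="\<lambda>_. 1"])
      show "AE \<xi> in gauss_product. (\<lambda>m. iexp (t * S m \<xi>)) \<longlonglongrightarrow> iexp (t * (\<Sum>j. a j * \<xi> j))"
        using conv
      proof eventually_elim
        case (elim \<xi>)
        then have "(\<lambda>m. S m \<xi>) \<longlonglongrightarrow> (\<Sum>j. a j * \<xi> j)" unfolding S_def by (rule summable_LIMSEQ)
        then show ?case by (intro tendsto_intros)
      qed
    qed auto
    moreover have "(\<lambda>m. CLINT \<xi>|gauss_product. iexp (t * S m \<xi>)) \<longlonglongrightarrow>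
       exp (- (t\<^sup>2 * (\<Sum>j. (a j)\<^sup>2)) / 2)"
      unfolding charS using summable_LIMSEQ[OF a] by (intro tendsto_intros) auto
    ultimately have "(CLINT \<xi>|gauss_product. iexp (t * (\<Sum>j. a j * \<xi> j))) = exp (- (t\<^sup>2 * (\<Sum>j. (a j)\<^sup>2)) / 2)"
      by (rule LIMSEQ_unique)
    moreover have "char (distr gauss_product borel (\<lambda>\<xi>. \<Sum>j. a j * \<xi> j)) t
        = (CLINT \<xi>|gauss_product. iexp (t * (\<Sum>j. a j * \<xi> j)))"
      unfolding char_def by (subst integral_distr) auto
    ultimately show "char (distr gauss_product borel (\<lambda>\<xi>. \<Sum>j. a j * \<xi> j)) t
      = char (distr std_gauss borel (\<lambda>x. sqrt (\<Sum>j. (a j)\<^sup>2) * x)) t"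
      by (simp add: char_scaled_std_gauss suminf_nonneg a)
  qed
qed

lemma integral_gauss_series:
  assumes a: "summable (\<lambda>j. (a j)\<^sup>2)"
    and conv: "AE \<xi> in gauss_product. summable (\<lambda>j. a j * \<xi> j)"
  shows "(\<integral>\<xi>. poly h (c + (\<Sum>j. a j * \<xi> j)) \<partial>gauss_product) = poly (heat (\<Sum>j. (a j)\<^sup>2) h) c"
proof -
  have [measurable]: "poly h \<in> borel_measurable borel"
    by (intro borel_measurable_continuous_onI continuous_intros)
  have "(\<integral>\<xi>. poly h (c + (\<Sum>j. a j * \<xi> j)) \<partial>gauss_product)
     = (\<integral>x. poly h (c + x) \<partial>distr gauss_product borel (\<lambda>\<xi>. \<Sum>j. a j * \<xi> j))"
    by (subst integral_distr) auto
  also have "\<dots> = (\<integral>x. poly h (c + sqrt (\<Sum>j. (a j)\<^sup>2) * x) \<partial>std_gauss)"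
    unfolding distr_gauss_series[OF assms] by (subst integral_distr) auto
  also have "\<dots> = poly (heat ((sqrt (\<Sum>j. (a j)\<^sup>2))\<^sup>2) h) c" by (rule poly_heat[symmetric])
  finally show ?thesis by (simp add: suminf_nonneg a)
qed

section \<open>Error of the sparse quadrature\<close>

text \<open>
  Quadrature evaluates \<open>g\<close> only at finitely supported \<open>\<xi>\<close>, where the series in its argument is a
  finite sum.
\<close>

lemma tensor_difference_eq:
  assumes g: "\<And>\<xi> m. (\<And>j. j \<ge> m \<Longrightarrow> \<xi> j = 0) \<Longrightarrow> g \<xi> = poly h (c + (\<Sum>j<m. a j * \<xi> j))"
    and \<nu>: "\<And>j. j \<ge> m \<Longrightarrow> \<nu> j = 0"
  shows "tensor_difference \<nu> g = poly (iterated_difference a \<nu> m h) c"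
proof -
  have partial: "partial_tensor \<nu> l g \<xi> = poly (iterated_difference a \<nu> l h) (c + (\<Sum>j=l..<n. a j * \<xi> j))"
    if "l \<le> n" "\<And>j. j \<ge> n \<Longrightarrow> \<xi> j = 0" for l n \<xi>
    using that
  proof (induction l arbitrary: \<xi>)
    case 0
    then show ?case by (simp add: g[of n] atLeast0LessThan)
  next
    case (Suc l)
    have "partial_tensor \<nu> l g (\<xi>(l := t)) = poly (iterated_difference a \<nu> l h)
       ((c + (\<Sum>j=Suc l..<n. a j * \<xi> j)) + a l * t)" for t
    proof -
      have "(\<Sum>j=l..<n. a j * (\<xi>(l := t)) j) = a l * t + (\<Sum>j=Suc l..<n. a j * \<xi> j)"
        using Suc.prems(1) by (subst sum.atLeast_Suc_lessThan) (auto intro!: sum.cong)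
      moreover have "partial_tensor \<nu> l g (\<xi>(l := t)) =
          poly (iterated_difference a \<nu> l h) (c + (\<Sum>j=l..<n. a j * (\<xi>(l := t)) j))"
        using Suc.prems by (intro Suc.IH) auto
      ultimately show ?thesis by (simp add: add_ac)
    qed
    then show ?case by (simp add: poly_difference_op)
  qed
  define n where "n = (LEAST m. \<forall>j\<ge>m. \<nu> j = 0)"
  have n: "\<forall>j\<ge>n. \<nu> j = 0" unfolding n_def by (rule LeastI[of _ m]) (use \<nu> in auto)
  have "n \<le> m" unfolding n_def by (rule Least_le) (use \<nu> in auto)
  have "tensor_difference \<nu> g = poly (iterated_difference a \<nu> n h) c"
    unfolding tensor_difference_def n_def[symmetric] by (subst partial[of n n]) auto
  also have "iterated_difference a \<nu> n h = iterated_difference a \<nu> m h"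
    using iterated_difference_beyond[OF \<open>n \<le> m\<close>, of \<nu> a h] n by simp
  finally show ?thesis .
qed

text \<open>
  The factor 0 for \<open>\<nu> j > k\<close> reflects that derivatives of order above the degree vanish. Hence only
  the boxes with bound \<open>k\<close> matter, independently of the index set of the quadrature.
\<close>

lemma jet_norm_iterated_difference:
  assumes h: "degree h \<le> k" and a: "\<And>j. \<bar>a j\<bar> \<le> A" "1 \<le> A"
  obtains C where "1 \<le> C" "\<And>\<nu> m. jet_norm k c (iterated_difference a \<nu> m h)
    \<le> (\<Prod>j<m. if \<nu> j \<le> k then (C * (a j)\<^sup>2) ^ \<nu> j else 0) * jet_norm k c h"
proof -
  define B where "B n = A ^ k * (\<Sum>i\<le>k. \<bar>gh_diff_moment n i\<bar>)" for n
  have B: "0 \<le> B n" for n using a by (simp add: B_def sum_nonneg)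
  define C where "C = 1 + (\<Sum>n\<le>k. B n)"
  have C: "1 \<le> C" using B by (simp add: C_def sum_nonneg)
  have step: "jet_norm k c (difference_op n (a j) p)
      \<le> (if n \<le> k then (C * (a j)\<^sup>2) ^ n else 0) * jet_norm k c p" if "degree p \<le> k" for n j p
  proof (cases "n = 0")
    case False
    have "jet_norm k c (difference_op n (a j) p) \<le> B n * ((a j)\<^sup>2) ^ n * jet_norm k c p"
      unfolding B_def by (rule jet_norm_difference_op[OF that a])
    also have "\<dots> \<le> (if n \<le> k then (C * (a j)\<^sup>2) ^ n else 0) * jet_norm k c p"
    proof (intro mult_right_mono jet_norm_nonneg)
      show "B n * ((a j)\<^sup>2) ^ n \<le> (if n \<le> k then (C * (a j)\<^sup>2) ^ n else 0)"
      proof (cases "n \<le> k")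
        case True
        have "B n \<le> (\<Sum>n\<le>k. B n)" using B True by (intro member_le_sum) auto
        also have "\<dots> \<le> C" by (simp add: C_def)
        also have "C \<le> C ^ n" using C False by (intro self_le_power) auto
        finally show ?thesis using True by (simp add: power_mult_distrib mult_right_mono)
      next
        case False
        then have "B n = 0" by (simp add: B_def gh_diff_moment_eq_0)
        then show ?thesis using False by simp
      qed
    qed
    finally show ?thesis .
  qed (simp add: difference_op_0)
  have "jet_norm k c (iterated_difference a \<nu> m h)
    \<le> (\<Prod>j<m. if \<nu> j \<le> k then (C * (a j)\<^sup>2) ^ \<nu> j else 0) * jet_norm k c h" for \<nu> m
  proof (induction m)
    case (Suc m)
    let ?u = "\<lambda>j. if \<nu> j \<le> k then (C * (a j)\<^sup>2) ^ \<nu> j else 0"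
    have "jet_norm k c (iterated_difference a \<nu> (Suc m) h) \<le> ?u m * jet_norm k c (iterated_difference a \<nu> m h)"
      using step[OF order_trans[OF degree_iterated_difference h]] by simp
    also have "\<dots> \<le> ?u m * ((\<Prod>j<m. ?u j) * jet_norm k c h)"
      using C by (intro mult_left_mono Suc.IH) auto
    finally show ?case by (simp add: mult_ac)
  qed simp
  with C show ?thesis by (rule that)
qed

text \<open>
  The quantity \<open>M\<close> bounds the sum of all \<open>\<bar>tensor_difference \<nu> g\<bar>\<close> weighted by \<open>\<Prod>j. \<sigma> j ^ \<nu> j\<close>. As the
  error is at most the unweighted sum over the omitted indices, a lower bound \<open>\<theta>\<close> for their weights
  gains a factor \<open>1 / \<theta>\<close>. The argument is carried out for the truncation to \<open>m\<close> variables, where the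
  mean is a finite sum of tensor differences, and \<open>m\<close> then tends to infinity.
\<close>

lemma sparse_quadrature_error_bound:
  assumes h: "degree h \<le> k" and a: "summable (\<lambda>j. (a j)\<^sup>2)"
    and \<sigma>: "\<And>j. 1 \<le> \<sigma> j" and wsum: "summable (\<lambda>j. \<sigma> j * (a j)\<^sup>2)"
    and g: "\<And>\<xi> m. (\<And>j. j \<ge> m \<Longrightarrow> \<xi> j = 0) \<Longrightarrow> g \<xi> = poly h (c + (\<Sum>j<m. a j * \<xi> j))"
  obtains M where "0 \<le> M" "\<And>\<Lambda> \<theta>. finite \<Lambda> \<Longrightarrow> \<Lambda> \<subseteq> multi_indices \<Longrightarrow> 0 < \<theta> \<Longrightarrow>
     (\<And>m \<nu>. \<nu> \<in> index_box m (\<lambda>_. k) - \<Lambda> \<Longrightarrow> \<theta> \<le> (\<Prod>j<m. \<sigma> j ^ \<nu> j)) \<Longrightarrow>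
     \<bar>poly (heat (\<Sum>j. (a j)\<^sup>2) h) c - sparse_quadrature \<Lambda> g\<bar> \<le> M / \<theta>"
proof -
  define s2 where "s2 = (\<Sum>j. (a j)\<^sup>2)"
  have "\<bar>a j\<bar> \<le> sqrt s2 + 1" for j
  proof -
    have "(a j)\<^sup>2 \<le> s2" unfolding s2_def using a sum_le_suminf[of "\<lambda>j. (a j)\<^sup>2" "{j}"] by simp
    then have "sqrt ((a j)\<^sup>2) \<le> sqrt s2" by (rule real_sqrt_le_mono)
    then show ?thesis by simp
  qed
  moreover have "1 \<le> sqrt s2 + 1" by (simp add: s2_def suminf_nonneg a)
  ultimately obtain C where C: "1 \<le> C" and bound: "\<And>\<nu> m. jet_norm k c (iterated_difference a \<nu> m h)
    \<le> (\<Prod>j<m. if \<nu> j \<le> k then (C * (a j)\<^sup>2) ^ \<nu> j else 0) * jet_norm k c h"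
    using jet_norm_iterated_difference[OF h] by blast
  define t where "t m \<nu> = poly (iterated_difference a \<nu> m h) c" for m \<nu>
  have t: "\<bar>t m \<nu>\<bar> \<le> (\<Prod>j<m. if \<nu> j \<le> k then (C * (a j)\<^sup>2) ^ \<nu> j else 0) * jet_norm k c h" for m \<nu>
    unfolding t_def using abs_poly_le_jet_norm bound by (rule order_trans)
  define w where "w j = C * (\<sigma> j * (a j)\<^sup>2)" for j
  have w: "0 \<le> w j" for j using C order_trans[OF zero_le_one \<sigma>] by (simp add: w_def)
  have ws: "summable w" unfolding w_def by (intro summable_mult wsum)
  define W where "W = (\<Sum>j. w j)"
  have wW: "w j \<le> W" for j unfolding W_def using ws w sum_le_suminf[of w "{j}"] by simp
  define D where "D = (\<Sum>n<k. W ^ n)"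
  \<comment> \<open>\<open>D\<close> makes the truncated geometric sum at most \<open>1 + D * w j\<close>, uniformly in \<open>j\<close>\<close>
  have D: "0 \<le> D" unfolding D_def using order_trans[OF w wW] by (intro sum_nonneg zero_le_power) blast
  define M where "M = exp (\<Sum>j. D * w j) * jet_norm k c h"
  have M: "(\<Sum>\<nu>\<in>index_box m (\<lambda>_. k). (\<Prod>j<m. \<sigma> j ^ \<nu> j) * \<bar>t m \<nu>\<bar>) \<le> M" for m
  proof -
    have "(\<Sum>\<nu>\<in>index_box m (\<lambda>_. k). (\<Prod>j<m. \<sigma> j ^ \<nu> j) * \<bar>t m \<nu>\<bar>)
      \<le> (\<Sum>\<nu>\<in>index_box m (\<lambda>_. k). (\<Prod>j<m. w j ^ \<nu> j) * jet_norm k c h)"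
    proof (rule sum_mono)
      fix \<nu> assume "\<nu> \<in> index_box m (\<lambda>_. k)"
      then have "(\<Prod>j<m. if \<nu> j \<le> k then (C * (a j)\<^sup>2) ^ \<nu> j else 0) = (\<Prod>j<m. (C * (a j)\<^sup>2) ^ \<nu> j)"
        by (intro prod.cong) (auto simp: index_box_def)
      then have "(\<Prod>j<m. \<sigma> j ^ \<nu> j) * \<bar>t m \<nu>\<bar> \<le> (\<Prod>j<m. \<sigma> j ^ \<nu> j) * ((\<Prod>j<m. (C * (a j)\<^sup>2) ^ \<nu> j) * jet_norm k c h)"
        using t[of m \<nu>] order_trans[OF zero_le_one \<sigma>] by (intro mult_left_mono prod_nonneg) auto
      also have "\<dots> = (\<Prod>j<m. w j ^ \<nu> j) * jet_norm k c h"
        by (simp add: w_def prod.distrib power_mult_distrib mult_ac)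
      finally show "(\<Prod>j<m. \<sigma> j ^ \<nu> j) * \<bar>t m \<nu>\<bar> \<le> (\<Prod>j<m. w j ^ \<nu> j) * jet_norm k c h" .
    qed
    also have "\<dots> = (\<Prod>j<m. \<Sum>n\<le>k. w j ^ n) * jet_norm k c h"
      using sum_prod_index_box[of "\<lambda>j n. w j ^ n" m "\<lambda>_. k"] by (simp add: sum_distrib_right[symmetric])
    also have "\<dots> \<le> (\<Prod>j<m. 1 + D * w j) * jet_norm k c h"
    proof (intro mult_right_mono prod_mono conjI jet_norm_nonneg sum_nonneg zero_le_power w)
      fix j
      have "(\<Sum>n\<le>k. w j ^ n) = 1 + (\<Sum>n<k. w j * w j ^ n)"
        by (subst sum.atMost_shift) simp
      also have "(\<Sum>n<k. w j * w j ^ n) \<le> (\<Sum>n<k. w j * W ^ n)"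
        using w wW by (intro sum_mono mult_left_mono power_mono) auto
      finally show "(\<Sum>n\<le>k. w j ^ n) \<le> 1 + D * w j"
        by (simp add: D_def sum_distrib_left[symmetric] mult.commute)
    qed
    also have "\<dots> \<le> M" unfolding M_def
      using w D by (intro mult_right_mono prod_one_plus_le_exp summable_mult ws jet_norm_nonneg) auto
    finally show ?thesis .
  qed
  show thesis
  proof (rule that[of M])
    show "0 \<le> M" by (simp add: M_def jet_norm_nonneg)
    fix \<Lambda> :: "(nat \<Rightarrow> nat) set" and \<theta> :: real
    assume \<Lambda>: "finite \<Lambda>" "\<Lambda> \<subseteq> multi_indices" and \<theta>: "0 < \<theta>"
      and low: "\<And>m \<nu>. \<nu> \<in> index_box m (\<lambda>_. k) - \<Lambda> \<Longrightarrow> \<theta> \<le> (\<Prod>j<m. \<sigma> j ^ \<nu> j)"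
    obtain m0 K0 where m0: "\<Lambda> \<subseteq> index_box m0 (\<lambda>_. K0)" using multi_indices_bound \<Lambda> by blast
    have err: "\<bar>poly (heat (\<Sum>j<m. (a j)\<^sup>2) h) c - sparse_quadrature \<Lambda> g\<bar> \<le> M / \<theta>" if "m0 \<le> m" for m
    proof -
      let ?I = "index_box m (\<lambda>_. k)"
      have supp: "\<nu> j = 0" if "\<nu> \<in> \<Lambda>" "j \<ge> m" for \<nu> j
        using that m0 \<open>m0 \<le> m\<close> by (force simp: index_box_def)
      have zero: "t m \<nu> = 0" if \<nu>: "\<nu> \<in> \<Lambda> - ?I" for \<nu>
      proof -
        obtain i where i: "i < m" "\<not> \<nu> i \<le> k" using \<nu> supp[of \<nu>] by (auto simp: index_box_def)
        have p0: "(\<Prod>j<m. if \<nu> j \<le> k then (C * (a j)\<^sup>2) ^ \<nu> j else 0) = 0"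
          using i by (intro prod_zero bexI[of _ i]) auto
        show ?thesis using t[of m \<nu>] unfolding p0 by simp
      qed
      have "sparse_quadrature \<Lambda> g = (\<Sum>\<nu>\<in>\<Lambda>. t m \<nu>)"
        unfolding sparse_quadrature_def t_def using supp
        by (intro sum.cong refl tensor_difference_eq g) auto
      also have "\<dots> = (\<Sum>\<nu>\<in>\<Lambda> \<inter> ?I. t m \<nu>)"
        using \<Lambda> zero by (intro sum.mono_neutral_right) auto
      finally have q: "sparse_quadrature \<Lambda> g = (\<Sum>\<nu>\<in>\<Lambda> \<inter> ?I. t m \<nu>)" .
      have "poly (heat (\<Sum>j<m. (a j)\<^sup>2) h) c = (\<Sum>\<nu>\<in>?I. t m \<nu>)"
        using h by (subst sum_iterated_difference[of h k, symmetric]) (auto simp: poly_sum t_def)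
      also have "\<dots> = (\<Sum>\<nu>\<in>?I - \<Lambda>. t m \<nu>) + (\<Sum>\<nu>\<in>\<Lambda> \<inter> ?I. t m \<nu>)"
        by (subst sum.Int_Diff[OF finite_index_box, of _ _ _ \<Lambda>]) (simp add: Int_commute add.commute)
      finally have "\<bar>poly (heat (\<Sum>j<m. (a j)\<^sup>2) h) c - sparse_quadrature \<Lambda> g\<bar> \<le> (\<Sum>\<nu>\<in>?I - \<Lambda>. \<bar>t m \<nu>\<bar>)"
        unfolding q by simp
      also have "\<dots> \<le> (\<Sum>\<nu>\<in>?I - \<Lambda>. (\<Prod>j<m. \<sigma> j ^ \<nu> j) * \<bar>t m \<nu>\<bar> / \<theta>)"
      proof (rule sum_mono)
        fix \<nu> assume "\<nu> \<in> ?I - \<Lambda>"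
        then have "\<theta> * \<bar>t m \<nu>\<bar> \<le> (\<Prod>j<m. \<sigma> j ^ \<nu> j) * \<bar>t m \<nu>\<bar>"
          by (intro mult_right_mono low) auto
        then show "\<bar>t m \<nu>\<bar> \<le> (\<Prod>j<m. \<sigma> j ^ \<nu> j) * \<bar>t m \<nu>\<bar> / \<theta>"
          using \<theta> by (simp add: field_simps)
      qed
      also have "\<dots> \<le> (\<Sum>\<nu>\<in>?I. (\<Prod>j<m. \<sigma> j ^ \<nu> j) * \<bar>t m \<nu>\<bar> / \<theta>)"
        using \<theta> order_trans[OF zero_le_one \<sigma>]
        by (intro sum_mono2 finite_index_box divide_nonneg_nonneg mult_nonneg_nonneg prod_nonneg) auto
      also have "\<dots> \<le> M / \<theta>"
        using M[of m] \<theta> by (simp add: sum_divide_distrib[symmetric] divide_right_mono)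
      finally show ?thesis .
    qed
    have cont: "isCont (\<lambda>v. poly (heat v h) c) v" for v
      unfolding heat_def by (simp add: poly_sum)
    have "(\<lambda>m. \<bar>poly (heat (\<Sum>j<m. (a j)\<^sup>2) h) c - sparse_quadrature \<Lambda> g\<bar>)
       \<longlonglongrightarrow> \<bar>poly (heat (\<Sum>j. (a j)\<^sup>2) h) c - sparse_quadrature \<Lambda> g\<bar>"
      by (intro tendsto_intros isCont_tendsto_compose[OF cont] summable_LIMSEQ a)
    then show "\<bar>poly (heat (\<Sum>j. (a j)\<^sup>2) h) c - sparse_quadrature \<Lambda> g\<bar> \<le> M / \<theta>"
      by (rule LIMSEQ_le_const2) (use err in blast)
  qed
qed

text \<open>
  For \<open>\<rho> > 1\<close> the weight \<open>\<sigma> j = 1 + (\<tau> j)\<^sup>2\<close> with \<open>\<tau> j = (j + 1) powr \<rho>\<close> just compensates the decay of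
  \<open>(a j)\<^sup>2\<close>, and the square summable \<open>\<phi>\<close> provides the summability. For \<open>\<rho> \<le> 1\<close> the exponent \<open>s\<close> is negative,
  and the trivial weight 1 shows that the error is bounded, whatever the index sets are.
\<close>

lemma sparse_quadrature_rate:
  fixes h :: "real poly" and a \<phi> :: "nat \<Rightarrow> real" and \<rho> s K :: real
  assumes h: "degree h \<le> k" and \<rho>: "0 < \<rho>" and s: "s < \<rho> - 1"
    and K: "0 < K" "\<And>j. (a j)\<^sup>2 \<le> K * real (Suc j) powr - (2 * \<rho>) * (\<phi> j)\<^sup>2"
    and \<phi>: "summable (\<lambda>j. (\<phi> j)\<^sup>2)"
    and g: "\<And>\<xi> m. (\<And>j. j \<ge> m \<Longrightarrow> \<xi> j = 0) \<Longrightarrow> g \<xi> = poly h (c + (\<Sum>j<m. a j * \<xi> j))"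
  obtains q C :: real and \<tau> :: "nat \<Rightarrow> real"
  where "0 < q" "q < 1" "\<And>j. 0 < \<tau> j" "summable (\<lambda>j. (1 / \<tau> j) powr q)"
    "\<And>N. 1 \<le> N \<Longrightarrow> \<exists>\<Lambda>. admissible \<Lambda> \<and>
       smallest_indices (multi_weight (weight_order q) \<tau>) N \<Lambda> \<and>
       \<bar>poly (heat (\<Sum>j. (a j)\<^sup>2) h) c - sparse_quadrature \<Lambda> g\<bar> \<le> C * real (N + 1) powr (- s)"
proof -
  have pw: "real (Suc j) powr - (2 * \<rho>) \<le> 1" for j
    using \<rho> powr_mono[of "- (2 * \<rho>)" 0 "real (Suc j)"] by simp
  have "(a j)\<^sup>2 \<le> K * (\<phi> j)\<^sup>2" for j
  proof -
    have "K * real (Suc j) powr - (2 * \<rho>) * (\<phi> j)\<^sup>2 \<le> K * 1 * (\<phi> j)\<^sup>2"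
      using pw[of j] K by (intro mult_right_mono mult_left_mono) auto
    then show ?thesis using K(2)[of j] by simp
  qed
  then have a: "summable (\<lambda>j. (a j)\<^sup>2)"
    by (intro summable_comparison_test'[OF summable_mult[OF \<phi>, of K], of 0]) simp
  show thesis
  proof (cases "1 < \<rho>")
    case True
    \<comment> \<open>any value between \<open>1 / \<rho>\<close> and 1 with \<open>2 / q \<ge> s\<close> would do\<close>
    define q where "q = 2 / (1 + \<rho>)"
    have q: "0 < q" "q < 1" "1 < \<rho> * q" using True by (auto simp: q_def field_simps)
    define \<tau> where "\<tau> j = real (Suc j) powr \<rho>" for j
    obtain M1 where M1: "summable (\<lambda>j. (1 / \<tau> j) powr q)" "0 < M1"
      "\<And>N. \<exists>\<Lambda>. admissible \<Lambda> \<and> smallest_indices (multi_weight (weight_order q) \<tau>) N \<Lambda> \<and>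
        (\<forall>\<nu>\<in>multi_indices - \<Lambda>. (real N / M1) powr (2 / q) \<le> multi_weight (weight_order q) \<tau> \<nu>)"
      using smallest_indices_power_weights[OF q] unfolding \<tau>_def by metis
    have \<tau>: "1 \<le> \<tau> j" for j unfolding \<tau>_def using \<rho> by (intro ge_one_powr_ge_zero) auto
    have "(1 + (\<tau> j)\<^sup>2) * (a j)\<^sup>2 \<le> 2 * K * (\<phi> j)\<^sup>2" for j
    proof -
      have "1 \<le> (\<tau> j)\<^sup>2" using \<tau>[of j] by simp
      then have "(1 + (\<tau> j)\<^sup>2) * (a j)\<^sup>2 \<le> (2 * (\<tau> j)\<^sup>2) * (K * real (Suc j) powr - (2 * \<rho>) * (\<phi> j)\<^sup>2)"
        using K by (intro mult_mono) auto
      also have "\<dots> = 2 * K * (\<phi> j)\<^sup>2 * ((\<tau> j)\<^sup>2 * real (Suc j) powr - (2 * \<rho>))" by (simp add: mult_ac)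
      also have "(\<tau> j)\<^sup>2 * real (Suc j) powr - (2 * \<rho>) = 1"
        unfolding \<tau>_def by (simp add: power2_eq_square powr_add[symmetric])
      finally show ?thesis by simp
    qed
    then have ws: "summable (\<lambda>j. (1 + (\<tau> j)\<^sup>2) * (a j)\<^sup>2)"
      by (intro summable_comparison_test'[OF summable_mult[OF \<phi>, of "2 * K"], of 0]) simp
    have \<sigma>: "1 \<le> 1 + (\<tau> j)\<^sup>2" for j by simp
    obtain M2 where M2: "0 \<le> M2" "\<And>\<Lambda> \<theta>. finite \<Lambda> \<Longrightarrow> \<Lambda> \<subseteq> multi_indices \<Longrightarrow> 0 < \<theta> \<Longrightarrow>
       (\<And>m \<nu>. \<nu> \<in> index_box m (\<lambda>_. k) - \<Lambda> \<Longrightarrow> \<theta> \<le> (\<Prod>j<m. (1 + (\<tau> j)\<^sup>2) ^ \<nu> j)) \<Longrightarrow>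
       \<bar>poly (heat (\<Sum>j. (a j)\<^sup>2) h) c - sparse_quadrature \<Lambda> g\<bar> \<le> M2 / \<theta>"
      using sparse_quadrature_error_bound[where \<sigma>="\<lambda>j. 1 + (\<tau> j)\<^sup>2", OF h a \<sigma> ws g] by blast
    define C where "C = M2 * (2 * M1) powr (2 / q)"
    show thesis
    proof (rule that[of q \<tau> C])
      show "0 < \<tau> j" for j using \<tau>[of j] by simp
      fix N :: nat assume N: "1 \<le> N"
      obtain \<Lambda> where \<Lambda>: "admissible \<Lambda>" "smallest_indices (multi_weight (weight_order q) \<tau>) N \<Lambda>"
        "\<And>\<nu>. \<nu> \<in> multi_indices - \<Lambda> \<Longrightarrow> (real N / M1) powr (2 / q) \<le> multi_weight (weight_order q) \<tau> \<nu>"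
        using M1(3)[of N] by blast
      have "\<bar>poly (heat (\<Sum>j. (a j)\<^sup>2) h) c - sparse_quadrature \<Lambda> g\<bar> \<le> M2 / (real N / M1) powr (2 / q)"
      proof (rule M2(2))
        show "0 < (real N / M1) powr (2 / q)" using N M1(2) by simp
        fix m \<nu> assume \<nu>: "\<nu> \<in> index_box m (\<lambda>_. k) - \<Lambda>"
        then have "\<nu> \<in> multi_indices - \<Lambda>" using index_box_multi_indices by blast
        then have "(real N / M1) powr (2 / q) \<le> multi_weight (weight_order q) \<tau> \<nu>" by (rule \<Lambda>(3))
        also have "\<dots> \<le> (\<Prod>j<m. (1 + (\<tau> j)\<^sup>2) ^ \<nu> j)"
          using \<nu> by (intro multi_weight_le_prod) (simp add: index_box_def)
        finally show "(real N / M1) powr (2 / q) \<le> (\<Prod>j<m. (1 + (\<tau> j)\<^sup>2) ^ \<nu> j)" .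
      qed (use \<Lambda>(2) in \<open>auto simp: smallest_indices_def\<close>)
      \<comment> \<open>\<open>N \<ge> (N + 1) / 2\<close> converts the bound to powers of \<open>N + 1\<close>\<close>
      also have "\<dots> \<le> M2 / (real (N + 1) / (2 * M1)) powr (2 / q)"
      proof (intro divide_left_mono M2(1) powr_mono2 mult_pos_pos)
        show "real (N + 1) / (2 * M1) \<le> real N / M1" using N M1(2) by (simp add: field_simps)
      qed (use N M1(2) q in auto)
      also have "\<dots> = C * real (N + 1) powr - (2 / q)"
        using M1(2) by (simp add: C_def powr_divide powr_minus_divide)
      also have "\<dots> \<le> C * real (N + 1) powr - s"
      proof (intro mult_left_mono powr_mono)
        show "- (2 / q) \<le> - s" using s True by (simp add: q_def)
      qed (use M2(1) in \<open>auto simp: C_def\<close>)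
      finally show "\<exists>\<Lambda>. admissible \<Lambda> \<and> smallest_indices (multi_weight (weight_order q) \<tau>) N \<Lambda> \<and>
         \<bar>poly (heat (\<Sum>j. (a j)\<^sup>2) h) c - sparse_quadrature \<Lambda> g\<bar> \<le> C * real (N + 1) powr (- s)"
        using \<Lambda>(1,2) by blast
    qed (use q M1 in auto)
  next
    case False
    \<comment> \<open>any pair with \<open>2 * q > 1\<close> serves, as only boundedness of the error is at stake\<close>
    define q :: real where "q = 3 / 4"
    have q: "0 < q" "q < 1" "1 < 2 * q" by (auto simp: q_def)
    define \<tau> where "\<tau> j = real (Suc j) powr 2" for j
    obtain M1 where M1: "summable (\<lambda>j. (1 / \<tau> j) powr q)"
      "\<And>N. \<exists>\<Lambda>. admissible \<Lambda> \<and> smallest_indices (multi_weight (weight_order q) \<tau>) N \<Lambda>"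
      using smallest_indices_power_weights[OF q] unfolding \<tau>_def by metis
    have ws: "summable (\<lambda>j. 1 * (a j)\<^sup>2)" using a by simp
    obtain M2 where M2: "0 \<le> M2" "\<And>\<Lambda> \<theta>. finite \<Lambda> \<Longrightarrow> \<Lambda> \<subseteq> multi_indices \<Longrightarrow> 0 < \<theta> \<Longrightarrow>
       (\<And>m \<nu>. \<nu> \<in> index_box m (\<lambda>_. k) - \<Lambda> \<Longrightarrow> \<theta> \<le> (\<Prod>j<m. 1 ^ \<nu> j)) \<Longrightarrow>
       \<bar>poly (heat (\<Sum>j. (a j)\<^sup>2) h) c - sparse_quadrature \<Lambda> g\<bar> \<le> M2 / \<theta>"
      using sparse_quadrature_error_bound[where \<sigma>="\<lambda>_. 1", OF h a order_refl ws g] by blast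
    show thesis
    proof (rule that[of q \<tau> M2])
      show "0 < \<tau> j" for j by (simp add: \<tau>_def)
      fix N :: nat assume N: "1 \<le> N"
      obtain \<Lambda> where \<Lambda>: "admissible \<Lambda>" "smallest_indices (multi_weight (weight_order q) \<tau>) N \<Lambda>"
        using M1(2) by blast
      have "\<bar>poly (heat (\<Sum>j. (a j)\<^sup>2) h) c - sparse_quadrature \<Lambda> g\<bar> \<le> M2 / 1"
        using \<Lambda>(2) by (intro M2(2)) (auto simp: smallest_indices_def)
      also have "\<dots> \<le> M2 * real (N + 1) powr - s"
      proof -
        have "1 \<le> real (N + 1) powr - s" using s False by (intro ge_one_powr_ge_zero) auto
        then show ?thesis using mult_left_mono[OF _ M2(1), of 1] by simp
      qed
      finally show "\<exists>\<Lambda>. admissible \<Lambda> \<and> smallest_indices (multi_weight (weight_order q) \<tau>) N \<Lambda> \<and>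
         \<bar>poly (heat (\<Sum>j. (a j)\<^sup>2) h) c - sparse_quadrature \<Lambda> g\<bar> \<le> M2 * real (N + 1) powr (- s)"
        using \<Lambda> by blast
    qed (use q M1 in auto)
  qed
qed

section \<open>Orthonormal bases and diagonal operators\<close>

lemma norm_orthonormal_sum:
  fixes e :: "nat \<Rightarrow> 'x::real_inner"
  assumes "\<And>i j. e i \<bullet> e j = (if i = j then 1 else 0)" "finite S"
  shows "(norm (\<Sum>j\<in>S. c j *\<^sub>R e j))\<^sup>2 = (\<Sum>j\<in>S. (c j)\<^sup>2)"
proof -
  have "(norm (\<Sum>j\<in>S. c j *\<^sub>R e j))\<^sup>2 = (\<Sum>i\<in>S. \<Sum>j\<in>S. if j = i then c i * c j else 0)"
    unfolding power2_norm_eq_inner inner_sum_left inner_sum_right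
    by (intro sum.cong refl) (simp add: assms(1))
  also have "\<dots> = (\<Sum>j\<in>S. (c j)\<^sup>2)"
    using assms(2) by (intro sum.cong refl) (simp add: power2_eq_square)
  finally show ?thesis .
qed

lemma orthonormal_series_summable:
  fixes e :: "nat \<Rightarrow> 'x::{real_inner, banach}"
  assumes e: "\<And>i j. e i \<bullet> e j = (if i = j then 1 else 0)" and c: "summable (\<lambda>j. (c j)\<^sup>2)"
  shows "summable (\<lambda>j. c j *\<^sub>R e j)"
  unfolding summable_Cauchy
proof (intro allI impI)
  fix \<epsilon> :: real assume "0 < \<epsilon>"
  then have "0 < \<epsilon>\<^sup>2" by simp
  then obtain N where N: "\<And>m n. m \<ge> N \<Longrightarrow> norm (\<Sum>j=m..<n. (c j)\<^sup>2) < \<epsilon>\<^sup>2"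
    using c unfolding summable_Cauchy by blast
  have "norm (\<Sum>j=m..<n. c j *\<^sub>R e j) < \<epsilon>" if "m \<ge> N" for m n
  proof -
    have "(norm (\<Sum>j=m..<n. c j *\<^sub>R e j))\<^sup>2 = (\<Sum>j=m..<n. (c j)\<^sup>2)"
      by (rule norm_orthonormal_sum[OF e]) simp
    also have "\<dots> < \<epsilon>\<^sup>2" using N[OF that, of n] by (simp add: sum_nonneg)
    finally show ?thesis using \<open>0 < \<epsilon>\<close> by (simp add: power_less_imp_less_base)
  qed
  then show "\<exists>N. \<forall>m\<ge>N. \<forall>n. norm (\<Sum>j=m..<n. c j *\<^sub>R e j) < \<epsilon>" by blast
qed

lemma bessel:
  fixes e :: "nat \<Rightarrow> 'x::real_inner"
  assumes e: "\<And>i j. e i \<bullet> e j = (if i = j then 1 else 0)"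
  shows "summable (\<lambda>j. (x \<bullet> e j)\<^sup>2)"
proof (rule summableI_nonneg_bounded)
  fix n
  let ?p = "\<Sum>j<n. (x \<bullet> e j) *\<^sub>R e j"
  have "x \<bullet> ?p = (\<Sum>j<n. (x \<bullet> e j)\<^sup>2)" by (simp add: inner_sum_right power2_eq_square)
  moreover have "(norm ?p)\<^sup>2 = (\<Sum>j<n. (x \<bullet> e j)\<^sup>2)" by (rule norm_orthonormal_sum[OF e]) simp
  moreover have "0 \<le> (norm (x - ?p))\<^sup>2" by simp
  ultimately show "(\<Sum>j<n. (x \<bullet> e j)\<^sup>2) \<le> (norm x)\<^sup>2"
    by (simp add: power2_norm_eq_inner inner_diff_left inner_diff_right inner_commute)
qed simp

locale orthonormal_basis_seq =
  fixes e :: "nat \<Rightarrow> 'x::{real_inner, banach}"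
  assumes orthonormal_basis: "orthonormal_basis e"
begin

lemma inner_e: "e i \<bullet> e j = (if i = j then 1 else 0)"
  using orthonormal_basis by (simp add: orthonormal_basis_def)

lemma eq_zeroI:
  assumes "\<And>i. x \<bullet> e i = 0"
  shows "x = 0"
proof -
  have "closed {z. x \<bullet> z = 0}" by (intro closed_Collect_eq continuous_intros)
  moreover have "span (range e) \<subseteq> {z. x \<bullet> z = 0}"
    using assms by (intro span_minimal) (auto simp: subspace_def inner_add_right)
  ultimately have "closure (span (range e)) \<subseteq> {z. x \<bullet> z = 0}" by (rule closure_minimal[rotated])
  then have "x \<in> {z. x \<bullet> z = 0}" using orthonormal_basis unfolding orthonormal_basis_def by (metis UNIV_I subsetD)
  then show ?thesis by simp
qed

lemma eqI: "(\<And>i. x \<bullet> e i = y \<bullet> e i) \<Longrightarrow> x = y"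
  using eq_zeroI[of "x - y"] by (simp add: inner_diff_left)

lemma inner_series:
  assumes "summable (\<lambda>j. (c j)\<^sup>2)"
  shows "(\<Sum>j. c j *\<^sub>R e j) \<bullet> x = (\<Sum>j. c j * (e j \<bullet> x))" "summable (\<lambda>j. c j * (e j \<bullet> x))"
  using orthonormal_series_summable[OF inner_e assms]
    bounded_linear.suminf[OF bounded_linear_inner_left, of "\<lambda>j. c j *\<^sub>R e j" x]
    bounded_linear.summable[OF bounded_linear_inner_left, of "\<lambda>j. c j *\<^sub>R e j" x] by simp_all

lemma series_coefficient:
  assumes "summable (\<lambda>j. (c j)\<^sup>2)"
  shows "(\<Sum>j. c j *\<^sub>R e j) \<bullet> e i = c i"
proof -
  have "(\<Sum>j. c j * (e j \<bullet> e i)) = (\<Sum>j\<in>{i}. c j * (e j \<bullet> e i))"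
    by (rule suminf_finite) (auto simp: inner_e)
  then show ?thesis using inner_series[OF assms] by (simp add: inner_e)
qed

lemma expansion: "(\<Sum>j. (x \<bullet> e j) *\<^sub>R e j) = x"
  by (rule eqI) (simp add: series_coefficient bessel[OF inner_e])

lemma parseval: "(\<lambda>j. (x \<bullet> e j) * (y \<bullet> e j)) sums (x \<bullet> y)"
  using inner_series[OF bessel[OF inner_e], of x y] unfolding expansion
  by (simp add: sums_iff inner_commute)

text \<open>
  The representing vector is the series with coefficients \<open>f (e j)\<close>; testing \<open>f\<close> on its partial sums
  shows that these coefficients are square summable.
\<close>

lemma riesz:
  fixes f :: "'x \<Rightarrow> real"
  assumes f: "bounded_linear f"
  obtains z where "\<And>x. f x = x \<bullet> z"
proof -
  interpret f: bounded_linear f by (rule f)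
  obtain K where K: "0 \<le> K" "\<And>x. norm (f x) \<le> norm x * K" using f.nonneg_bounded by blast
  have "(\<Sum>j<n. (f (e j))\<^sup>2) \<le> K\<^sup>2" for n
  proof -
    define v where "v = (\<Sum>j<n. f (e j) *\<^sub>R e j)"
    have v2: "(norm v)\<^sup>2 = (\<Sum>j<n. (f (e j))\<^sup>2)" unfolding v_def
      by (rule norm_orthonormal_sum[OF inner_e]) simp
    have "f v = (norm v)\<^sup>2" unfolding v2 by (simp add: v_def f.sum f.scaleR power2_eq_square)
    then have "norm v * norm v \<le> norm v * K" using K(2)[of v] by (simp add: power2_eq_square)
    then have "norm v \<le> K" using K(1) by (cases "norm v = 0") auto
    then show ?thesis unfolding v2[symmetric] by (intro power_mono) auto
  qed
  then have s: "summable (\<lambda>j. (f (e j))\<^sup>2)" by (intro summableI_nonneg_bounded) auto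
  have "f x = x \<bullet> (\<Sum>j. f (e j) *\<^sub>R e j)" for x
  proof -
    have "f x = (\<Sum>j. f ((x \<bullet> e j) *\<^sub>R e j))"
      using f.suminf[OF orthonormal_series_summable[OF inner_e bessel[OF inner_e]], of x]
      by (simp add: expansion)
    also have "\<dots> = x \<bullet> (\<Sum>j. f (e j) *\<^sub>R e j)"
      using inner_series(1)[OF s, of x] by (simp add: f.scaleR inner_commute mult.commute)
    finally show ?thesis .
  qed
  then show ?thesis by (rule that)
qed

lemma summable_functional_squares:
  assumes "bounded_linear f" shows "summable (\<lambda>j. (f (e j) :: real)\<^sup>2)"
proof -
  obtain z where "\<And>x. f x = x \<bullet> z" using riesz[OF assms] by metis
  then show ?thesis using bessel[OF inner_e, of z] by (simp add: inner_commute)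
qed

text \<open>
  The constant \<open>adjoint\<close> is a choice among all maps with this property; Riesz' theorem provides one.
\<close>

lemma adjoint_inner:
  fixes G :: "'x \<Rightarrow> 'y::real_inner"
  assumes G: "bounded_linear G"
  shows "x \<bullet> adjoint G y = G x \<bullet> y"
proof -
  have "\<exists>z. \<forall>x. G x \<bullet> y = x \<bullet> z" for y
  proof -
    have "bounded_linear (\<lambda>x. G x \<bullet> y)" using G by (rule bounded_linear_inner_left_comp)
    from riesz[OF this] show ?thesis by metis
  qed
  then have "\<exists>g. \<forall>x y. G x \<bullet> y = x \<bullet> g y" by metis
  then have "\<forall>x y. G x \<bullet> y = x \<bullet> adjoint G y" unfolding adjoint_def by (rule someI_ex)
  then show ?thesis by simp
qed

lemma bounded_linear_adjoint:
  fixes G :: "'x \<Rightarrow> 'y::real_inner"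
  assumes G: "bounded_linear G"
  shows "bounded_linear (adjoint G)"
proof -
  interpret G: bounded_linear G by (rule G)
  obtain K where K: "0 \<le> K" "\<And>x. norm (G x) \<le> norm x * K" using G.nonneg_bounded by blast
  show ?thesis
  proof (rule bounded_linear_intro)
    show "adjoint G (x + y) = adjoint G x + adjoint G y" for x y
      by (rule vector_eq_ldot[THEN iffD1]) (simp add: adjoint_inner[OF G] inner_add_right)
    show "adjoint G (r *\<^sub>R x) = r *\<^sub>R adjoint G x" for r x
      by (rule vector_eq_ldot[THEN iffD1]) (simp add: adjoint_inner[OF G])
    show "norm (adjoint G y) \<le> norm y * K" for y
    proof -
      let ?z = "adjoint G y"
      have "norm ?z * norm ?z = G ?z \<bullet> y"
        using adjoint_inner[OF G, of ?z y] by (simp add: power2_norm_eq_inner flip: power2_eq_square)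
      also have "\<dots> \<le> norm (G ?z) * norm y" by (rule norm_cauchy_schwarz)
      also have "\<dots> \<le> norm ?z * K * norm y" using K(2)[of ?z] by (rule mult_right_mono) simp
      finally have "norm ?z * norm ?z \<le> norm ?z * (norm y * K)" by (simp add: mult_ac)
      then show ?thesis using K(1) by (cases "norm ?z = 0") auto
    qed
  qed
qed

text \<open>
  The operator with eigenvectors \<open>e j\<close> and eigenvalues \<open>l j\<close>; \<open>spectral_power\<close> is of this form.
\<close>

definition diagonal :: "(nat \<Rightarrow> real) \<Rightarrow> 'x \<Rightarrow> 'x" where
  "diagonal l x = (\<Sum>j. (l j * (x \<bullet> e j)) *\<^sub>R e j)"

lemma power2_le_if_abs_le: "\<bar>x\<bar> \<le> K \<Longrightarrow> x\<^sup>2 \<le> (K::real)\<^sup>2"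
  using power_mono[of "\<bar>x\<bar>" K 2] by simp

lemma summable_diagonal:
  assumes "\<And>j. \<bar>l j\<bar> \<le> K" shows "summable (\<lambda>j. (l j * (x \<bullet> e j))\<^sup>2)"
proof (rule summable_comparison_test)
  show "summable (\<lambda>j. K\<^sup>2 * (x \<bullet> e j)\<^sup>2)" by (intro summable_mult bessel inner_e)
  have "(l n)\<^sup>2 \<le> K\<^sup>2" for n by (rule power2_le_if_abs_le[OF assms])
  then have "(l n)\<^sup>2 * (x \<bullet> e n)\<^sup>2 \<le> K\<^sup>2 * (x \<bullet> e n)\<^sup>2" for n by (rule mult_right_mono) simp
  then show "\<exists>N. \<forall>n\<ge>N. norm ((l n * (x \<bullet> e n))\<^sup>2) \<le> K\<^sup>2 * (x \<bullet> e n)\<^sup>2"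
    by (simp only: real_norm_def abs_power2 power_mult_distrib) simp
qed

lemma diagonal_inner_e:
  assumes "\<And>j. \<bar>l j\<bar> \<le> K" shows "diagonal l x \<bullet> e i = l i * (x \<bullet> e i)"
proof -
  have "summable (\<lambda>j. (l j * (x \<bullet> e j))\<^sup>2)" by (rule summable_diagonal[of l K x, OF assms])
  then show ?thesis
    unfolding diagonal_def by (rule series_coefficient[of "\<lambda>j. l j * (x \<bullet> e j)" i])
qed

lemma bounded_linear_diagonal:
  assumes l: "\<And>j. \<bar>l j\<bar> \<le> K" shows "bounded_linear (diagonal l)"
proof (rule bounded_linear_intro)
  show "diagonal l (x + y) = diagonal l x + diagonal l y" for x y
    by (rule eqI) (simp add: diagonal_inner_e[OF l] inner_add_left distrib_left)
  show "diagonal l (r *\<^sub>R x) = r *\<^sub>R diagonal l x" for r x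
    by (rule eqI) (simp add: diagonal_inner_e[OF l])
  show "norm (diagonal l x) \<le> norm x * K" for x
  proof -
    have "(l j * (x \<bullet> e j)) * (l j * (x \<bullet> e j)) \<le> K\<^sup>2 * ((x \<bullet> e j) * (x \<bullet> e j))" for j
    proof -
      have "(l j)\<^sup>2 \<le> K\<^sup>2" by (rule power2_le_if_abs_le[OF l])
      then have "(l j)\<^sup>2 * (x \<bullet> e j)\<^sup>2 \<le> K\<^sup>2 * (x \<bullet> e j)\<^sup>2" by (rule mult_right_mono) simp
      then show ?thesis by (simp add: power2_eq_square mult_ac)
    qed
    moreover have "(\<lambda>j. (l j * (x \<bullet> e j)) * (l j * (x \<bullet> e j))) sums (diagonal l x \<bullet> diagonal l x)"
      using parseval[of "diagonal l x" "diagonal l x"] unfolding diagonal_inner_e[OF l] .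
    moreover have "(\<lambda>j. K\<^sup>2 * ((x \<bullet> e j) * (x \<bullet> e j))) sums (K\<^sup>2 * (x \<bullet> x))"
      by (intro sums_mult parseval)
    ultimately have "diagonal l x \<bullet> diagonal l x \<le> K\<^sup>2 * (x \<bullet> x)" by (rule sums_le)
    then have "(norm (diagonal l x))\<^sup>2 \<le> (norm x * K)\<^sup>2"
      unfolding power_mult_distrib power2_norm_eq_inner[symmetric] by (simp only: mult.commute)
    moreover have "0 \<le> K" using abs_ge_zero l[of 0] by (rule order_trans)
    then have "0 \<le> norm x * K" by simp
    ultimately show ?thesis by (rule power2_le_imp_le)
  qed
qed

lemma diagonal_symmetric:
  assumes l: "\<And>j. \<bar>l j\<bar> \<le> K" shows "diagonal l x \<bullet> y = x \<bullet> diagonal l y"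
proof -
  have "(\<lambda>j. (diagonal l x \<bullet> e j) * (y \<bullet> e j)) = (\<lambda>j. (x \<bullet> e j) * (diagonal l y \<bullet> e j))"
    unfolding diagonal_inner_e[OF l] by (simp add: mult_ac)
  then show ?thesis
    using sums_unique2[OF parseval[of "diagonal l x" y]] parseval[of x "diagonal l y"] by simp
qed

lemma diagonal_diagonal:
  assumes l: "\<And>j. \<bar>l j\<bar> \<le> K" shows "diagonal l (diagonal l x) = diagonal (\<lambda>j. l j * l j) x"
proof (rule eqI)
  have l2: "\<bar>l j * l j\<bar> \<le> K * K" for j
    using l[of j] unfolding abs_mult by (intro mult_mono) auto
  show "diagonal l (diagonal l x) \<bullet> e i = diagonal (\<lambda>j. l j * l j) x \<bullet> e i" for i
    by (simp add: diagonal_inner_e[OF l] diagonal_inner_e[OF l2])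
qed

lemma inj_diagonal:
  assumes l: "\<And>j. \<bar>l j\<bar> \<le> K" "\<And>j. l j \<noteq> 0" shows "inj (diagonal l)"
proof (rule injI)
  fix x y assume "diagonal l x = diagonal l y"
  then have "diagonal l x \<bullet> e i = diagonal l y \<bullet> e i" for i by simp
  then have "l i * (x \<bullet> e i) = l i * (y \<bullet> e i)" for i
    unfolding diagonal_inner_e[OF l(1)] .
  then show "x = y" using l(2) by (intro eqI) simp
qed

end

text \<open>
  Lax-Milgram for the coercive operator \<open>1 + K\<close>: for small \<open>\<theta>\<close> the damped iteration
  \<open>u - \<theta> (u + K u - w)\<close> is a contraction.
\<close>

lemma identity_plus_positive_surj:
  fixes K :: "'x::{real_inner, banach} \<Rightarrow> 'x"
  assumes K: "bounded_linear K" and pos: "\<And>v. 0 \<le> K v \<bullet> v"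
  obtains u where "u + K u = w"
proof -
  interpret K: bounded_linear K by (rule K)
  obtain B where B: "0 \<le> B" "\<And>x. norm (K x) \<le> norm x * B" using K.nonneg_bounded by blast
  define L where "L = 1 + B"
  have L: "1 \<le> L" using B by (simp add: L_def)
  \<comment> \<open>minimises the contraction factor \<open>1 - 2 * \<theta> + \<theta>\<^sup>2 * L\<^sup>2\<close> of the squared norm\<close>
  define \<theta> where "\<theta> = 1 / L\<^sup>2"
  have \<theta>: "0 < \<theta>" "\<theta> \<le> 1" using L by (auto simp: \<theta>_def divide_le_eq_1)
  define F where "F u = u - \<theta> *\<^sub>R (u + K u - w)" for u
  have contr: "(norm (F u - F v))\<^sup>2 \<le> (1 - \<theta>) * (norm (u - v))\<^sup>2" for u v
  proof -
    define d where "d = u - v"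
    define g where "g = d + K d"
    have Fd: "F u - F v = d - \<theta> *\<^sub>R g"
      by (simp add: F_def d_def g_def K.diff algebra_simps)
    have "norm g \<le> L * norm d" using norm_triangle_ineq[of d "K d"] B(2)[of d]
      by (simp add: g_def L_def algebra_simps)
    then have "(norm g)\<^sup>2 \<le> (L * norm d)\<^sup>2" by (intro power_mono) auto
    then have "\<theta>\<^sup>2 * (norm g)\<^sup>2 \<le> \<theta>\<^sup>2 * (L * norm d)\<^sup>2" by (intro mult_left_mono) auto
    also have "\<dots> = \<theta> * (norm d)\<^sup>2" using L by (simp add: \<theta>_def power_mult_distrib power2_eq_square)
    finally have 1: "\<theta>\<^sup>2 * (norm g)\<^sup>2 \<le> \<theta> * (norm d)\<^sup>2" .
    have "(norm d)\<^sup>2 \<le> g \<bullet> d" using pos[of d] by (simp add: g_def inner_add_left power2_norm_eq_inner)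
    then have 2: "\<theta> * (norm d)\<^sup>2 \<le> \<theta> * (g \<bullet> d)" using \<theta> by (intro mult_left_mono) auto
    have "(norm (d - \<theta> *\<^sub>R g))\<^sup>2 = (norm d)\<^sup>2 - 2 * (\<theta> * (g \<bullet> d)) + \<theta>\<^sup>2 * (norm g)\<^sup>2"
      unfolding power2_norm_eq_inner
      by (simp add: inner_diff_left inner_diff_right inner_commute[of d g] power2_eq_square algebra_simps)
    also have "\<dots> \<le> (1 - \<theta>) * (norm d)\<^sup>2" using 1 2 by (simp add: algebra_simps)
    finally show ?thesis by (simp add: Fd d_def)
  qed
  have "\<exists>!u. F u = u"
  proof (rule banach_fix_type)
    show "0 \<le> sqrt (1 - \<theta>)" "sqrt (1 - \<theta>) < 1" using \<theta> by auto
    show "\<forall>u v. dist (F u) (F v) \<le> sqrt (1 - \<theta>) * dist u v"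
    proof (intro allI)
      fix u v
      have "norm (F u - F v) \<le> sqrt ((1 - \<theta>) * (norm (u - v))\<^sup>2)" by (rule real_le_rsqrt[OF contr])
      then show "dist (F u) (F v) \<le> sqrt (1 - \<theta>) * dist u v"
        by (simp add: dist_norm real_sqrt_mult)
    qed
  qed
  then obtain u where "F u = u" by blast
  then have "u + K u = w" using \<theta> by (simp add: F_def)
  then show ?thesis by (rule that)
qed

text \<open>
  A span of dimension \<open>n + 1\<close> cannot be projected injectively to one of dimension \<open>n\<close>.
\<close>

lemma exists_orthogonal_combination:
  fixes p q :: "nat \<Rightarrow> 'x::real_inner"
  assumes p: "\<And>i j. p i \<bullet> p j = (if i = j then 1 else 0)"
    and q: "\<And>i j. q i \<bullet> q j = (if i = j then 1 else 0)"
  obtains c where "(\<Sum>j\<le>n. c j *\<^sub>R p j) \<noteq> 0" "\<And>i. i < n \<Longrightarrow> (\<Sum>j\<le>n. c j *\<^sub>R p j) \<bullet> q i = 0"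
proof -
  define S where "S = p ` {..n}"
  have inj: "inj_on p {..n}" 
  proof (rule inj_onI)
    fix i j assume "p i = p j"
    then show "i = j" using p[of i i] p[of i j] by (simp split: if_splits)
  qed
  have S: "finite S" "card S = Suc n" unfolding S_def using card_image[OF inj] by auto
  have indep: "independent S"
  proof (rule pairwise_orthogonal_independent)
    show "pairwise orthogonal S" unfolding S_def pairwise_def orthogonal_def using p by auto
    have "p j \<noteq> 0" for j using p[of j j] by auto
    then show "0 \<notin> S" unfolding S_def by (metis imageE)
  qed
  define P where "P x = (\<Sum>i<n. (x \<bullet> q i) *\<^sub>R q i)" for x
  have P: "linear P"
    by (rule linearI) (simp_all add: P_def inner_add_left scaleR_add_left sum.distrib scaleR_sum_right)
  have "\<not> inj_on P (span S)"
  proof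
    assume inj: "inj_on P (span S)"
    have "independent (P ` S)" using P indep inj by (rule linear_independent_injective_image)
    moreover have "P ` S \<subseteq> span (q ` {..<n})"
    proof (intro image_subsetI)
      show "P x \<in> span (q ` {..<n})" for x
        unfolding P_def by (intro span_sum span_scale span_base) simp
    qed
    ultimately have "card (P ` S) \<le> card (q ` {..<n})" using independent_span_bound[of "q ` {..<n}"] by simp
    also have "\<dots> \<le> n" using card_image_le[of "{..<n}" q] by simp
    finally show False using S card_image[OF inj_on_subset[OF inj span_superset]] by simp
  qed
  then obtain y z where yz: "y \<in> span S" "z \<in> span S" "P y = P z" "y \<noteq> z"
    unfolding inj_on_def by blast
  define x where "x = y - z"
  have x: "x \<in> span S" "x \<noteq> 0" "P x = 0"
    using yz span_diff[OF yz(1,2)] linear_diff[OF P, of y z] by (simp_all add: x_def)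
  have "x \<in> range (\<lambda>u. \<Sum>v\<in>S. u v *\<^sub>R v)" using x(1) unfolding span_finite[OF S(1)] .
  then obtain u where u: "x = (\<Sum>v\<in>S. u v *\<^sub>R v)" by blast
  have xu: "x = (\<Sum>j\<le>n. u (p j) *\<^sub>R p j)"
    unfolding u S_def by (subst sum.reindex[OF inj]) (simp only: o_def)
  have xq: "x \<bullet> q i = 0" if "i < n" for i
  proof -
    have "P x \<bullet> q i = (\<Sum>l<n. if l = i then x \<bullet> q l else 0)"
      unfolding P_def inner_sum_left by (intro sum.cong refl) (simp add: q)
    then show ?thesis using that x(3) by simp
  qed
  show ?thesis
  proof (rule that)
    show "(\<Sum>j\<le>n. u (p j) *\<^sub>R p j) \<noteq> 0" unfolding xu[symmetric] by (rule x(2))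
    show "(\<Sum>j\<le>n. u (p j) *\<^sub>R p j) \<bullet> q i = 0" if "i < n" for i
      unfolding xu[symmetric] using that by (rule xq)
  qed
qed

section \<open>Eigenvalues of the posterior covariance\<close>

text \<open>
  The min-max principle for \<open>C\<^sub>1 = (B + C\<^sup>-\<^sup>1)\<^sup>-\<^sup>1 \<le> C\<close> with \<open>C = diagonal \<kappa>\<close>. On the span of the first
  \<open>n + 1\<close> eigenvectors of \<open>C\<^sub>1\<close> the form of \<open>B + C\<^sup>-\<^sup>1\<close> is at most \<open>1 / l n\<close> on unit vectors; this span
  contains a unit vector orthogonal to \<open>e 0, \<dots>, e (n - 1)\<close>, on which the form of \<open>C\<^sup>-\<^sup>1\<close> is at least \<open>1 / \<kappa> n\<close>.

  Since \<open>C\<^sub>1\<close> is given by \<open>inv_into\<close>, its values are meaningful only once \<open>B + C\<^sup>-\<^sup>1\<close> is known to be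
  surjective on the range of \<open>C\<close>. With \<open>S\<close> the square root of \<open>C\<close>, the equation \<open>B x + C\<^sup>-\<^sup>1 x = z\<close> becomes
  \<open>u + S (B (S u)) = S z\<close> for \<open>x = S u\<close>, which is solvable because \<open>S B S\<close> is positive.
\<close>

lemma (in orthonormal_basis_seq) inverse_sum_eigenvalue_le:
  fixes B C\<^sub>1 :: "'x \<Rightarrow> 'x"
  assumes B: "bounded_linear B" and Bpos: "\<And>v. 0 \<le> B v \<bullet> v"
    and \<kappa>: "\<And>j. 0 < \<kappa> j" "decseq \<kappa>"
    and C\<^sub>1: "C\<^sub>1 = inv_into (range (diagonal \<kappa>)) (\<lambda>x. B x + inv (diagonal \<kappa>) x)"
    and p: "\<And>i j. p i \<bullet> p j = (if i = j then 1 else 0)"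
    and eig: "\<And>j. C\<^sub>1 (p j) = l j *\<^sub>R p j" "decseq l"
  shows "0 < l n" "l n \<le> \<kappa> n"
proof -
  interpret B: bounded_linear B by (rule B)
  define T where "T x = B x + inv (diagonal \<kappa>) x" for x
  define S where "S = diagonal (\<lambda>j. sqrt (\<kappa> j))"
  have bk: "\<bar>\<kappa> j\<bar> \<le> \<kappa> 0" for j using \<kappa>(1)[of j] decseqD[OF \<kappa>(2), of 0 j] by simp
  have bs: "\<bar>sqrt (\<kappa> j)\<bar> \<le> sqrt (\<kappa> 0)" for j using bk[of j] \<kappa>(1)[of j] by simp
  interpret C: bounded_linear "diagonal \<kappa>" by (rule bounded_linear_diagonal[OF bk])
  interpret S: bounded_linear S unfolding S_def by (rule bounded_linear_diagonal[OF bs])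
  have SS: "S (S x) = diagonal \<kappa> x" for x
    unfolding S_def diagonal_diagonal[OF bs] using \<kappa>(1) by (simp add: less_imp_le)
  have Ssym: "S x \<bullet> y = x \<bullet> S y" for x y unfolding S_def by (rule diagonal_symmetric[OF bs])
  have injC: "inj (diagonal \<kappa>)" using \<kappa>(1) by (intro inj_diagonal[OF bk]) (metis less_irrefl)
  have TC: "T (diagonal \<kappa> v) = B (diagonal \<kappa> v) + v" for v
    using injC by (simp add: T_def inv_f_f)
  have surj: "z \<in> T ` range (diagonal \<kappa>)" for z
  proof -
    have "bounded_linear (\<lambda>u. S (B (S u)))"
      by (intro bounded_linear_compose[OF S.bounded_linear_axioms]
          bounded_linear_compose[OF B S.bounded_linear_axioms])
    moreover have "0 \<le> S (B (S u)) \<bullet> u" for u using Bpos[of "S u"] by (simp add: Ssym)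
    ultimately obtain u where u: "u + S (B (S u)) = S z" by (rule identity_plus_positive_surj)
    define v where "v = z - B (S u)"
    have "u = S v" using u by (simp add: v_def S.diff algebra_simps)
    then have Su: "diagonal \<kappa> v = S u" by (simp add: SS)
    have "T (diagonal \<kappa> v) = B (S u) + v" unfolding TC unfolding Su ..
    then have "T (diagonal \<kappa> v) = z" by (simp add: v_def)
    then show ?thesis by blast
  qed
  have C\<^sub>1T: "T (C\<^sub>1 z) = z" "C\<^sub>1 z \<in> range (diagonal \<kappa>)" for z
    using f_inv_into_f[OF surj] inv_into_into[OF surj] unfolding C\<^sub>1 T_def by auto
  have "\<exists>v. diagonal \<kappa> v = p j \<and> B (p j) + v = (1 / l j) *\<^sub>R p j \<and> 0 < l j" for j
  proof -
    obtain w where w: "C\<^sub>1 (p j) = diagonal \<kappa> w" using C\<^sub>1T(2)[of "p j"] by blast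
    have pj: "p j \<bullet> p j = 1" by (simp add: p)
    have eq: "B (l j *\<^sub>R p j) + w = p j" using C\<^sub>1T(1)[of "p j"] TC[of w] w eig(1)[of j] by simp
    have l0: "l j \<noteq> 0"
    proof
      assume "l j = 0"
      then have "diagonal \<kappa> w = diagonal \<kappa> 0" using w eig(1)[of j] by (simp add: C.zero)
      then have "w = 0" by (rule injD[OF injC])
      then show False using eq \<open>l j = 0\<close> pj by (simp add: B.zero)
    qed
    define v where "v = (1 / l j) *\<^sub>R w"
    have "diagonal \<kappa> w = l j *\<^sub>R p j" using w eig(1)[of j] by simp
    then have v: "diagonal \<kappa> v = p j" using l0 by (simp add: v_def C.scaleR)
    have "B (p j) + v = (1 / l j) *\<^sub>R (B (l j *\<^sub>R p j) + w)"
      using l0 by (simp add: v_def B.scaleR scaleR_add_right)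
    then have Bv: "B (p j) + v = (1 / l j) *\<^sub>R p j" using eq by simp
    have "S v \<noteq> 0"
    proof
      assume "S v = 0"
      then have "p j = 0" using v SS[of v] by (simp add: S.zero)
      then show False using pj by simp
    qed
    then have "0 < S v \<bullet> S v" by simp
    also have "S v \<bullet> S v = v \<bullet> p j" using v SS[of v] by (simp add: Ssym)
    also have "\<dots> \<le> (B (p j) + v) \<bullet> p j" using Bpos[of "p j"] by (simp add: inner_add_left)
    also have "\<dots> = 1 / l j" unfolding Bv by (simp add: pj)
    finally show ?thesis using v Bv by auto
  qed
  then obtain v where v: "\<And>j. diagonal \<kappa> (v j) = p j"
    "\<And>j. B (p j) + v j = (1 / l j) *\<^sub>R p j" and lpos: "\<And>j. 0 < l j" by metis
  show "0 < l n" by (rule lpos)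
  obtain c where c: "(\<Sum>j\<le>n. c j *\<^sub>R p j) \<noteq> 0" "\<And>i. i < n \<Longrightarrow> (\<Sum>j\<le>n. c j *\<^sub>R p j) \<bullet> e i = 0"
    using exists_orthogonal_combination[of p e n, OF p inner_e] by blast
  define x where "x = (\<Sum>j\<le>n. c j *\<^sub>R p j)"
  define V where "V = (\<Sum>j\<le>n. c j *\<^sub>R v j)"
  have CV: "diagonal \<kappa> V = x" by (simp add: V_def x_def C.sum C.scaleR v(1))
  have xx: "x \<bullet> x = (\<Sum>j\<le>n. (c j)\<^sup>2)"
    using norm_orthonormal_sum[OF p, of "{..n}" c] by (simp add: x_def power2_norm_eq_inner)
  have "B x + V = (\<Sum>j\<le>n. c j *\<^sub>R (B (p j) + v j))"
    by (simp add: x_def V_def B.sum B.scaleR scaleR_add_right sum.distrib)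
  also have "\<dots> = (\<Sum>j\<le>n. (c j / l j) *\<^sub>R p j)" by (simp add: v(2))
  finally have "(B x + V) \<bullet> x = (\<Sum>j\<le>n. (c j / l j) * (p j \<bullet> x))" by (simp add: inner_sum_left)
  also have "\<dots> = (\<Sum>j\<le>n. (c j)\<^sup>2 / l j)"
  proof (intro sum.cong refl)
    fix j assume "j \<in> {..n}"
    have "p j \<bullet> x = (\<Sum>i\<le>n. if i = j then c i else 0)"
      unfolding x_def inner_sum_right by (intro sum.cong refl) (simp add: p)
    also have "\<dots> = c j" using \<open>j \<in> {..n}\<close> by simp
    finally show "(c j / l j) * (p j \<bullet> x) = (c j)\<^sup>2 / l j" by (simp add: power2_eq_square)
  qed
  also have "\<dots> \<le> (\<Sum>j\<le>n. (c j)\<^sup>2 / l n)"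
    using lpos decseqD[OF eig(2)] by (intro sum_mono divide_left_mono) auto
  finally have "(B x + V) \<bullet> x \<le> (x \<bullet> x) / l n" by (simp add: xx sum_divide_distrib)
  then have Vx: "V \<bullet> x \<le> (x \<bullet> x) / l n" using Bpos[of x] by (simp add: inner_add_left)
  have "x \<bullet> x \<le> \<kappa> n * (V \<bullet> x)"
  proof (rule sums_le[OF _ parseval sums_mult[OF parseval]])
    fix i
    have xe: "x \<bullet> e i = \<kappa> i * (V \<bullet> e i)" using diagonal_inner_e[of \<kappa> "\<kappa> 0" V i, OF bk] by (simp only: CV)
    show "x \<bullet> e i * (x \<bullet> e i) \<le> \<kappa> n * (V \<bullet> e i * (x \<bullet> e i))"
    proof (cases "i < n")
      case True then show ?thesis using c(2)[of i] by (simp add: x_def)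
    next
      case False
      then have "\<kappa> i * (\<kappa> i * (V \<bullet> e i)\<^sup>2) \<le> \<kappa> n * (\<kappa> i * (V \<bullet> e i)\<^sup>2)"
        using \<kappa>(1)[of i] decseqD[OF \<kappa>(2), of n i] by (intro mult_right_mono) auto
      then show ?thesis unfolding xe by (simp add: power2_eq_square mult_ac)
    qed
  qed
  also have "\<dots> \<le> \<kappa> n * ((x \<bullet> x) / l n)" using \<kappa>(1)[of n] Vx by (intro mult_left_mono) auto
  finally have "(x \<bullet> x) * l n \<le> (x \<bullet> x) * \<kappa> n" using lpos[of n] by (simp add: field_simps)
  moreover have "0 < x \<bullet> x" using c(1) by (simp add: x_def)
  ultimately show "l n \<le> \<kappa> n" by simp
qed

lemma inv_positive_operator:
  fixes \<Gamma> :: "'y::real_inner \<Rightarrow> 'y"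
  assumes "pos_def_op UNIV \<Gamma>" "boundedly_invertible_op UNIV \<Gamma>"
  shows "bounded_linear (inv \<Gamma>)" "0 \<le> inv \<Gamma> w \<bullet> w"
proof -
  show bl: "bounded_linear (inv \<Gamma>)" using assms(2) by (simp add: boundedly_invertible_op_def)
  have "\<Gamma> (inv \<Gamma> w) = w" using assms(2)
    by (simp add: boundedly_invertible_op_def bij_is_surj surj_f_inv_f)
  moreover have "0 \<le> \<Gamma> v \<bullet> v" for v
  proof (cases "v = 0")
    case False then show ?thesis using assms(1) by (simp add: pos_def_op_def less_imp_le)
  qed simp
  ultimately show "0 \<le> inv \<Gamma> w \<bullet> w" by (metis inner_commute)
qed

lemma posterior_eigenvalue_bound:
  fixes G :: "'x::{real_inner, banach, polish_space} \<Rightarrow> 'y::{real_inner, banach, polish_space}"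
  assumes A: "laplacian_like d D\<^sub>A A lam \<psi>" and \<alpha>: "0 < \<alpha>"
    and G: "bounded_linear G"
    and \<Gamma>: "pos_def_op UNIV \<Gamma>" "boundedly_invertible_op UNIV \<Gamma>"
    and eig: "orthonormal_basis \<psi>\<^sub>1"
      "\<And>j. posterior_cov G \<Gamma> (spectral_power lam \<psi> (- \<alpha>)) (\<psi>\<^sub>1 j) = lam\<^sub>1 j *\<^sub>R \<psi>\<^sub>1 j" "decseq lam\<^sub>1"
  obtains K where "0 < K" "\<And>j. 0 < lam\<^sub>1 j"
    "\<And>j. lam\<^sub>1 j \<le> K * real (Suc j) powr - (2 * (\<alpha> / real d))"
proof -
  interpret orthonormal_basis_seq \<psi>
    using A by unfold_locales (simp add: laplacian_like_def)
  interpret G: bounded_linear G by (rule G)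
  obtain c where c: "0 < c" "\<And>j. c * real (Suc j) powr (2 / real d) \<le> lam j"
    using A by (auto simp: laplacian_like_def)
  have lam: "0 < lam j" for j
    using c(1) by (intro less_le_trans[OF _ c(2)] mult_pos_pos) auto
  define B where "B x = adjoint G (inv \<Gamma> (G x))" for x
  have bB: "bounded_linear B" unfolding B_def
    by (intro bounded_linear_compose[OF bounded_linear_adjoint[OF G]]
        bounded_linear_compose[OF inv_positive_operator(1)[OF \<Gamma>] G])
  have Bpos: "0 \<le> B v \<bullet> v" for v
    using inv_positive_operator(2)[OF \<Gamma>, of "G v"] adjoint_inner[OF G, of v "inv \<Gamma> (G v)"]
    by (simp add: B_def inner_commute)
  define \<kappa> where "\<kappa> j = lam j powr - \<alpha>" for j
  have \<kappa>: "0 < \<kappa> j" for j using lam[of j] by (simp add: \<kappa>_def)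
  have dec: "decseq \<kappa>" unfolding decseq_def \<kappa>_def
    using A \<alpha> lam by (auto intro!: powr_mono2' simp: laplacian_like_def incseq_def)
  have eqC: "spectral_power lam \<psi> (- \<alpha>) = diagonal \<kappa>"
    by (simp add: fun_eq_iff spectral_power_def diagonal_def \<kappa>_def)
  have p: "\<psi>\<^sub>1 i \<bullet> \<psi>\<^sub>1 j = (if i = j then 1 else 0)" for i j
    using eig(1) by (simp add: orthonormal_basis_def)
  have "posterior_cov G \<Gamma> (diagonal \<kappa>) = inv_into (range (diagonal \<kappa>)) (\<lambda>x. B x + inv (diagonal \<kappa>) x)"
    by (simp add: posterior_cov_def B_def)
  note le = inverse_sum_eigenvalue_le[OF bB Bpos \<kappa> dec this p eig(2)[unfolded eqC] eig(3)]
  show thesis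
  proof (rule that)
    show "0 < c powr - \<alpha>" using c by simp
    show "0 < lam\<^sub>1 j" for j by (rule le(1))
    show "lam\<^sub>1 j \<le> c powr - \<alpha> * real (Suc j) powr - (2 * (\<alpha> / real d))" for j
    proof -
      have "lam\<^sub>1 j \<le> lam j powr - \<alpha>" using le(2)[of j] by (simp add: \<kappa>_def)
      also have "\<dots> \<le> (c * real (Suc j) powr (2 / real d)) powr - \<alpha>"
        using c \<alpha> by (intro powr_mono2') auto
      also have "\<dots> = c powr - \<alpha> * real (Suc j) powr - (2 * (\<alpha> / real d))"
        using c by (simp add: powr_mult powr_powr)
      finally show ?thesis .
    qed
  qed
qed

text \<open>
  An orthogonal series converges if and only if its coefficients are square summable; this holds for
  almost every \<open>\<xi>\<close> and for every finitely supported one, which are the arguments seen by the integral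
  and by the quadrature respectively.
\<close>

lemma functional_of_kl_expansion:
  fixes \<psi>\<^sub>1 :: "nat \<Rightarrow> 'x::{real_inner, banach}"
  assumes onb: "orthonormal_basis \<psi>\<^sub>1" and f: "bounded_linear f" and l: "\<And>j. 0 \<le> l j"
    and s: "summable (\<lambda>j. l j * (\<xi> j)\<^sup>2)"
  shows "summable (\<lambda>j. (sqrt (l j) * f (\<psi>\<^sub>1 j)) * \<xi> j)"
    and "f (kl_expansion m l \<psi>\<^sub>1 \<xi>) = f m + (\<Sum>j. (sqrt (l j) * f (\<psi>\<^sub>1 j)) * \<xi> j :: real)"
proof -
  interpret orthonormal_basis_seq \<psi>\<^sub>1 by unfold_locales (rule onb)
  interpret f: bounded_linear f by (rule f)
  have "summable (\<lambda>j. (sqrt (l j) * \<xi> j)\<^sup>2)" using s l by (simp add: power_mult_distrib)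
  then have sm: "summable (\<lambda>j. (sqrt (l j) * \<xi> j) *\<^sub>R \<psi>\<^sub>1 j)"
    by (rule orthonormal_series_summable[OF inner_e])
  have eq: "f ((sqrt (l j) * \<xi> j) *\<^sub>R \<psi>\<^sub>1 j) = (sqrt (l j) * f (\<psi>\<^sub>1 j)) * \<xi> j" for j
    by (simp add: f.scaleR mult_ac)
  show "summable (\<lambda>j. (sqrt (l j) * f (\<psi>\<^sub>1 j)) * \<xi> j)"
    using f.summable[OF sm] by (simp add: eq)
  show "f (kl_expansion m l \<psi>\<^sub>1 \<xi>) = f m + (\<Sum>j. (sqrt (l j) * f (\<psi>\<^sub>1 j)) * \<xi> j)"
    using f.suminf[OF sm] by (simp add: kl_expansion_def f.add eq)
qed

section \<open>Convergence rate for the Bayesian inverse problem\<close>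

theorem theorem4p6:
  fixes d :: nat and \<alpha> :: real
    and D\<^sub>A :: "'x::{real_inner, banach, polish_space} set" and A :: "'x \<Rightarrow> 'x"
    and lam :: "nat \<Rightarrow> real" and \<psi> :: "nat \<Rightarrow> 'x"
    and C\<^sub>0 C\<^sub>1 :: "'x \<Rightarrow> 'x"
    and G :: "'x \<Rightarrow> 'y::{real_inner, banach, polish_space}" and \<Gamma> :: "'y \<Rightarrow> 'y" and y :: 'y
    and m\<^sub>0 m\<^sub>1 :: 'x and lam\<^sub>1 :: "nat \<Rightarrow> real" and \<psi>\<^sub>1 :: "nat \<Rightarrow> 'x"
    and f :: "'x \<Rightarrow> real" and k :: nat and Q :: "'x \<Rightarrow> real"
  assumes d: "d \<in> {1, 2, 3}"
    and A: "laplacian_like d D\<^sub>A A lam \<psi>"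
    and \<alpha>: "\<alpha> > real d / 2"
    and C\<^sub>0: "C\<^sub>0 = spectral_power lam \<psi> (- \<alpha>)"
    and G: "bounded_linear G"
    and \<Gamma>: "bounded_linear \<Gamma>" "self_adjoint_op UNIV \<Gamma>" "pos_def_op UNIV \<Gamma>"
      "boundedly_invertible_op UNIV \<Gamma>"
    and C\<^sub>1: "C\<^sub>1 = posterior_cov G \<Gamma> C\<^sub>0"
    and m\<^sub>1: "is_map_point G \<Gamma> y (spectral_power lam \<psi> (- (\<alpha> / 2))) m\<^sub>0 m\<^sub>1"
    and eig\<^sub>1: "orthonormal_basis \<psi>\<^sub>1" "\<And>j. C\<^sub>1 (\<psi>\<^sub>1 j) = lam\<^sub>1 j *\<^sub>R \<psi>\<^sub>1 j" "decseq lam\<^sub>1"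
    and f: "bounded_linear f"
    and k: "k \<ge> 1"
    and Q: "\<And>m. Q m = f m ^ k"
  shows "\<forall>s::real. s < \<alpha> / real d - 1 \<longrightarrow>
    (\<exists>(q::real) (\<tau>::nat \<Rightarrow> real) (C::real).
       0 < q \<and> q < 1 \<and> (\<forall>j. \<tau> j > 0) \<and> summable (\<lambda>j. (1 / \<tau> j) powr q) \<and>
       (\<forall>N::nat. N \<ge> 1 \<longrightarrow>
          (\<exists>\<Lambda>. admissible \<Lambda> \<and>
               smallest_indices (multi_weight (weight_order q) \<tau>) N \<Lambda> \<and>
               \<bar>(\<integral>\<xi>. Q (kl_expansion m\<^sub>1 lam\<^sub>1 \<psi>\<^sub>1 \<xi>) \<partial>gauss_product) -
                 sparse_quadrature \<Lambda> (\<lambda>\<xi>. Q (kl_expansion m\<^sub>1 lam\<^sub>1 \<psi>\<^sub>1 \<xi>))\<bar>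
                 \<le> C * real (N + 1) powr (- s))))"
proof (intro allI impI)
  fix s :: real assume s: "s < \<alpha> / real d - 1"
  define \<rho> where "\<rho> = \<alpha> / real d"
  have d0: "0 < real d" using d by auto
  have \<alpha>0: "0 < \<alpha>" using \<alpha> d0 by linarith
  have \<rho>: "1 < 2 * \<rho>" "0 < \<rho>" using \<alpha> d0 by (simp_all add: \<rho>_def field_simps)
  interpret f: bounded_linear f by (rule f)
  interpret onb: orthonormal_basis_seq \<psi>\<^sub>1 by unfold_locales (rule eig\<^sub>1(1))
  obtain K where K: "0 < K" "\<And>j. 0 < lam\<^sub>1 j" "\<And>j. lam\<^sub>1 j \<le> K * real (Suc j) powr - (2 * \<rho>)"
    using posterior_eigenvalue_bound[OF A \<alpha>0 G \<Gamma>(3,4) eig\<^sub>1(1) eig\<^sub>1(2)[unfolded C\<^sub>1 C\<^sub>0] eig\<^sub>1(3)]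
    unfolding \<rho>_def by metis
  have nn: "0 \<le> lam\<^sub>1 j" for j using K(2)[of j] by simp
  define a where "a j = sqrt (lam\<^sub>1 j) * f (\<psi>\<^sub>1 j)" for j
  define h :: "real poly" where "h = monom 1 k"
  have h: "degree h \<le> k" "poly h x = x ^ k" for x by (simp_all add: h_def degree_monom_le poly_monom)
  let ?g = "\<lambda>\<xi>. Q (kl_expansion m\<^sub>1 lam\<^sub>1 \<psi>\<^sub>1 \<xi>)"
  have \<phi>: "summable (\<lambda>j. (f (\<psi>\<^sub>1 j))\<^sup>2)" by (rule onb.summable_functional_squares[OF f])
  have ab: "(a j)\<^sup>2 \<le> K * real (Suc j) powr - (2 * \<rho>) * (f (\<psi>\<^sub>1 j))\<^sup>2" for j
    using K(3)[of j] nn[of j] by (simp add: a_def power_mult_distrib mult_right_mono)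
  have "summable (\<lambda>n. real n powr - (2 * \<rho>))" using \<rho> by (simp add: summable_real_powr_iff)
  then have "summable (\<lambda>j. K * real (Suc j) powr - (2 * \<rho>))"
    by (intro summable_mult) (subst summable_Suc_iff)
  then have lsum: "summable lam\<^sub>1"
    by (rule summable_comparison_test'[where N = 0]) (use K nn in \<open>simp add: less_imp_le\<close>)
  have asum: "summable (\<lambda>j. (a j)\<^sup>2)"
  proof (rule summable_comparison_test'[where N = 0])
    show "summable (\<lambda>j. lam\<^sub>1 0 * (f (\<psi>\<^sub>1 j))\<^sup>2)" by (rule summable_mult[OF \<phi>])
    show "norm ((a j)\<^sup>2) \<le> lam\<^sub>1 0 * (f (\<psi>\<^sub>1 j))\<^sup>2" for j
      using decseqD[OF eig\<^sub>1(3), of 0 j] nn[of j] by (simp add: a_def power_mult_distrib mult_right_mono)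
  qed
  have AE: "AE \<xi> in gauss_product. summable (\<lambda>j. a j * \<xi> j) \<and> ?g \<xi> = poly h (f m\<^sub>1 + (\<Sum>j. a j * \<xi> j))"
    using AE_summable_weighted_squares[OF nn lsum]
  proof eventually_elim
    case (elim \<xi>)
    show ?case
      using functional_of_kl_expansion(1)[OF eig\<^sub>1(1) f nn elim]
        functional_of_kl_expansion(2)[OF eig\<^sub>1(1) f nn elim, of m\<^sub>1] by (simp add: a_def Q h)
  qed
  have [measurable]: "f \<in> borel_measurable borel"
    by (intro borel_measurable_continuous_onI linear_continuous_on f)
  have [measurable]: "poly h \<in> borel_measurable borel"
    by (intro borel_measurable_continuous_onI continuous_intros)
  have [measurable]: "(\<lambda>\<xi>. kl_expansion m\<^sub>1 lam\<^sub>1 \<psi>\<^sub>1 \<xi>) \<in> borel_measurable gauss_product"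
    unfolding kl_expansion_def by measurable
  have "(\<integral>\<xi>. ?g \<xi> \<partial>gauss_product) = (\<integral>\<xi>. poly h (f m\<^sub>1 + (\<Sum>j. a j * \<xi> j)) \<partial>gauss_product)"
  proof (rule integral_cong_AE)
    show "?g \<in> borel_measurable gauss_product" unfolding Q by measurable
    show "AE \<xi> in gauss_product. ?g \<xi> = poly h (f m\<^sub>1 + (\<Sum>j. a j * \<xi> j))"
      using AE by eventually_elim simp
  qed measurable
  also have "\<dots> = poly (heat (\<Sum>j. (a j)\<^sup>2) h) (f m\<^sub>1)"
    using AE by (intro integral_gauss_series asum) (auto elim: eventually_mono)
  finally have E: "(\<integral>\<xi>. ?g \<xi> \<partial>gauss_product) = poly (heat (\<Sum>j. (a j)\<^sup>2) h) (f m\<^sub>1)" .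
  have g: "?g \<xi> = poly h (f m\<^sub>1 + (\<Sum>j<m. a j * \<xi> j))" if "\<And>j. j \<ge> m \<Longrightarrow> \<xi> j = 0" for \<xi> m
  proof -
    have fin: "n \<notin> {..<m} \<Longrightarrow> \<xi> n = 0" for n using that[of n] by simp
    have "summable (\<lambda>j. lam\<^sub>1 j * (\<xi> j)\<^sup>2)" by (rule summable_finite[of "{..<m}"]) (auto simp: fin)
    from functional_of_kl_expansion(2)[OF eig\<^sub>1(1) f nn this, of m\<^sub>1]
    have "?g \<xi> = poly h (f m\<^sub>1 + (\<Sum>j. a j * \<xi> j))" by (simp add: a_def Q h)
    also have "(\<Sum>j. a j * \<xi> j) = (\<Sum>j<m. a j * \<xi> j)" by (rule suminf_finite) (auto simp: fin)
    finally show ?thesis .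
  qed
  obtain q C \<tau> where "0 < q" "q < 1" "\<And>j. 0 < \<tau> j" "summable (\<lambda>j. (1 / \<tau> j) powr q)"
    "\<And>N. 1 \<le> N \<Longrightarrow> \<exists>\<Lambda>. admissible \<Lambda> \<and>
       smallest_indices (multi_weight (weight_order q) \<tau>) N \<Lambda> \<and>
       \<bar>poly (heat (\<Sum>j. (a j)\<^sup>2) h) (f m\<^sub>1) - sparse_quadrature \<Lambda> ?g\<bar> \<le> C * real (N + 1) powr (- s)"
    using sparse_quadrature_rate[OF h(1) \<rho>(2) s[folded \<rho>_def] K(1) ab \<phi> g] by metis
  then show "\<exists>(q::real) (\<tau>::nat \<Rightarrow> real) (C::real).
       0 < q \<and> q < 1 \<and> (\<forall>j. \<tau> j > 0) \<and> summable (\<lambda>j. (1 / \<tau> j) powr q) \<and>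
       (\<forall>N::nat. N \<ge> 1 \<longrightarrow>
          (\<exists>\<Lambda>. admissible \<Lambda> \<and>
               smallest_indices (multi_weight (weight_order q) \<tau>) N \<Lambda> \<and>
               \<bar>(\<integral>\<xi>. ?g \<xi> \<partial>gauss_product) - sparse_quadrature \<Lambda> ?g\<bar> \<le> C * real (N + 1) powr (- s)))"
    unfolding E by blast
qed

end
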